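(* Let $X_n$ be the protection number of a random non-plane binary tree of size $n$. Let $T(z)$ be the generating function of non-plane binary trees, $\rho$ its dominant singularity, and for $k\ge 0$ let $T_k(z)$ be the generating function of non-plane binary trees with protection number at least $k$. Then $$\lim_{n\to\infty}\mathbb{E}X_n=\sum_{k\ge 1}\prod_{i=1}^{k-1}\left(\rho\,T_i(\rho)\right)\approx 1.707603060723366$$ and $$\lim_{n\to\infty}\mathbb{V}X_n\approx 0.431102549825064.$$
   Context: A non-plane binary tree is an unlabelled non-plane rooted tree (an isomorphism class of finite rooted trees) in which every vertex has either $0$ children (a leaf) or exactly $2$ children (an internal vertex). Its size is its number of internal vertices (so the single leaf has size $0$). A random non-plane binary tree of size $n$ is chosen uniformly among all non-plane binary trees of size $n$. The protection number of a rooted tree is the length (number of edges) of the shortest path from the root to a leaf; the single-vertex tree has protection number $0$. The generating function $T(z)$, with $z$ marking internal vertices, satisfies $T(z)=1+z\left(\frac12T(z)^2+\frac12T(z^2)\right)$. One has $T_0(z)=T(z)$ and $T_k(z)=z\left(\frac12T_{k-1}(z)^2+\frac12T_{k-1}(z^2)\right)$ for $k\ge 1$. The dominant singularity $\rho\approx 0.4026975036714$ is the (positive) radius of convergence of $T(z)$, where $T$ has a square root singularity with $T(\rho)=1/\rho$. An empty product equals $1$. $\mathbb{E}$ and $\mathbb{V}$ denote expectation and variance.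
   Formalization: The printed decimals are wrong: the first three terms of the stated sum already exceed 1.7135. The limit of the mean is shown to be 1.715793233559341 and that of the variance 0.444920980472840 (each within 5e-16), in place of 1.707603060723366 and 0.431102549825064. *)

theory Defs
  imports
    "HOL-Library.Multiset"
    "HOL-Analysis.FPS_Convergence"
    "HOL-Probability.Probability"
begin

text \<open>
  A finite unlabelled non-plane rooted tree is determined up to isomorphism by the multiset of
  the subtrees at the children of its root, so the elements of the following type are exactly the
  isomorphism classes of finite rooted trees.
\<close>

datatype rtree = Node "rtree multiset"

inductive is_binary :: "rtree \<Rightarrow> bool" where
  "size M \<in> {0, 2} \<Longrightarrow> (\<forall>c. c \<in># M \<longrightarrow> is_binary c) \<Longrightarrow> is_binary (Node M)"

primrec internal_vertices :: "rtree \<Rightarrow> nat" where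
  "internal_vertices (Node M) =
     (if M = {#} then 0 else 1) + sum_mset (image_mset internal_vertices M)"

text \<open>\<open>root_leaf_path t l\<close>: there is a path with \<open>l\<close> edges from the root of \<open>t\<close> down to a leaf.\<close>

inductive root_leaf_path :: "rtree \<Rightarrow> nat \<Rightarrow> bool" where
  leaf: "root_leaf_path (Node {#}) 0"
| step: "c \<in># M \<Longrightarrow> root_leaf_path c l \<Longrightarrow> root_leaf_path (Node M) (Suc l)"

definition protection_number :: "rtree \<Rightarrow> nat" where
  "protection_number t = (LEAST l. root_leaf_path t l)"

definition binary_trees :: "nat \<Rightarrow> rtree set" where
  "binary_trees n = {t. is_binary t \<and> internal_vertices t = n}"

definition T :: "real fps" where
  "T = Abs_fps (\<lambda>n. of_nat (card (binary_trees n)))"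

definition T_prot :: "nat \<Rightarrow> real fps" where
  "T_prot k = Abs_fps (\<lambda>n. of_nat (card {t \<in> binary_trees n. protection_number t \<ge> k}))"

text \<open>The coefficients of \<open>T\<close> are nonnegative, so its dominant singularity is its radius of
  convergence.\<close>

definition \<rho> :: real where
  "\<rho> = real_of_ereal (fps_conv_radius T)"

definition random_binary_tree :: "nat \<Rightarrow> rtree pmf" where
  "random_binary_tree n = pmf_of_set (binary_trees n)"

text \<open>\<open>pmf_of_set\<close> is the uniform distribution only on finite nonempty sets, and \<open>LEAST\<close> is only
  meaningful if there is a witness; the next lemmas ensure this.\<close>

lemma internal_vertices_0_iff: "internal_vertices t = 0 \<longleftrightarrow> t = Node {#}"
  by (cases t) auto

lemma is_binary_cases:
  assumes "is_binary t"
  obtains "t = Node {#}"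
  | a b where "t = Node {#a, b#}" "is_binary a" "is_binary b"
  using assms
proof (cases rule: is_binary.cases)
  case (1 M)
  have "M = {#} \<or> (\<exists>a b. M = {#a, b#})"
  proof (cases "M = {#}")
    case False
    then have "size M = Suc (Suc 0)" using 1 by auto
    moreover from this obtain a N where "M = add_mset a N"
      using size_eq_Suc_imp_eq_union by blast
    moreover from calculation obtain b N' where "N = add_mset b N'"
      using size_eq_Suc_imp_eq_union by fastforce
    ultimately have "M = {#a, b#}" by simp
    then show ?thesis by blast
  qed simp
  then consider "M = {#}" | a b where "M = {#a, b#}" by blast
  then show thesis
    using 1 that by cases auto
qed

lemma is_binary_leaf: "is_binary (Node {#})"
  by (rule is_binary.intros) auto

lemma is_binary_branch: "is_binary a \<Longrightarrow> is_binary b \<Longrightarrow> is_binary (Node {#a, b#})"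
  by (rule is_binary.intros) auto

lemma finite_binary_trees: "finite (binary_trees n)"
proof (induction n rule: less_induct)
  case (less n)
  define U where "U = (\<Union>i<n. binary_trees i)"
  have "finite U"
    using less by (auto simp: U_def)
  have "binary_trees n \<subseteq> insert (Node {#}) ((\<lambda>(a, b). Node {#a, b#}) ` (U \<times> U))"
  proof
    fix t assume t: "t \<in> binary_trees n"
    then have "is_binary t" by (simp add: binary_trees_def)
    then show "t \<in> insert (Node {#}) ((\<lambda>(a, b). Node {#a, b#}) ` (U \<times> U))"
    proof (cases rule: is_binary_cases)
      case (2 a b)
      then have "a \<in> U" "b \<in> U"
        using t by (auto simp: U_def binary_trees_def)
      then show ?thesis using 2 by auto
    qed auto
  qed
  then show ?case
    using \<open>finite U\<close> by (meson finite_SigmaI finite_imageI finite_insert finite_subset)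
qed

lemma binary_trees_nonempty: "binary_trees n \<noteq> {}"
proof (induction n)
  case 0
  show ?case using is_binary_leaf by (auto simp: binary_trees_def internal_vertices_0_iff)
next
  case (Suc n)
  then obtain t where "t \<in> binary_trees n" by blast
  then have "Node {#t, Node {#}#} \<in> binary_trees (Suc n)"
    using is_binary_branch is_binary_leaf by (auto simp: binary_trees_def)
  then show ?case by blast
qed

lemma ex_root_leaf_path: "\<exists>l. root_leaf_path t l"
proof (induction t)
  case (Node M)
  show ?case
  proof (cases "M = {#}")
    case True
    then show ?thesis using root_leaf_path.leaf by blast
  next
    case False
    then obtain c where "c \<in># M" by blast
    then show ?thesis using Node root_leaf_path.step by blast
  qed
qed

text \<open>
  The decimal constants in the theorem are the limits rounded to 15 decimals. The published source
  prints 1.707603060723366 (mean) and 0.431102549825064 (variance) instead. These digits are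
  inconsistent with its own formula: they arise, digit for digit, from evaluating
  \<open>T_prot k\<close> at \<open>\<rho>\<close> for \<open>k \<ge> 2\<close> with a spurious extra factor \<open>\<rho> / 2\<close> on the term
  \<open>T_prot (k - 1)\<close> at \<open>\<rho>\<^sup>2\<close> of the recurrence.
\<close>

end

theory Submission
  imports Defs "HOL-Complex_Analysis.Complex_Analysis" "HOL-Real_Asymp.Real_Asymp"
begin

text \<open>
  Let \<open>w k n\<close> be the number of trees with \<open>n\<close> internal vertices and protection number at least
  \<open>k\<close>, so that \<open>w k n / w 0 n\<close> is the probability of \<open>X\<^sub>n \<ge> k\<close>, and let \<open>F k\<close> be the function
  defined by the power series \<open>T_prot k\<close>. The root of a tree with protection number above \<open>k\<close> has
  two branches with protection number at least \<open>k\<close>, so \<open>w (k + 1)\<close> is, up to a shift by the root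
  and a diagonal term for two equal branches, half of the convolution square of \<open>w k\<close>
  (\<open>w_Suc_Suc\<close>).

  The analytic input is that \<open>w 0 n / w 0 (n + 1)\<close> tends to \<open>\<rho>\<close> (\<open>w_0_ratio\<close>): the square of \<open>1 -
  z * T z\<close> is analytic beyond \<open>\<rho>\<close>, with \<open>\<rho>\<close> as its only and simple zero in the closed disc, so
  that \<open>T\<close> has a square root singularity (\<open>sqrt_singularity_ratio\<close>). By the recurrence, these
  ratios already determine the convolution square of \<open>w 0\<close>: it is asymptotically \<open>2 / \<rho>\<close> times \<open>w
  0\<close>, and \<open>1 / \<rho> = T \<rho>\<close>. This says that only terms near the two ends of the convolution matter.
  The same then holds for the smaller sequences \<open>w k\<close> (\<open>convolution_square_ratio_tendsto\<close>), and if
  the probability of \<open>X\<^sub>n \<ge> k\<close> tends to \<open>p k\<close>, then that of \<open>X\<^sub>n \<ge> k + 1\<close> tends to \<open>\<rho> * F k \<rho> * p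
  k\<close>. By induction the limits are the products in the statement (\<open>w_tail_tendsto\<close>).

  The mean is the sum of the tail probabilities over \<open>k \<ge> 1\<close>, and the second moment is the same
  sum with the weights \<open>2 * k - 1\<close>. A geometric bound on the tails that is uniform in \<open>n\<close>
  (\<open>w_tail_geometric\<close>) allows passing to the limit term by term.

  For the decimals, the functional equation is quadratic in \<open>T x\<close> with the parameter \<open>T (x\<^sup>2)\<close>.
  Super- and subsolutions give rigorous bounds at the powers \<open>\<rho> ^ (2 ^ j)\<close>, starting from a tiny
  argument where \<open>T\<close> is almost 1, and \<open>\<rho>\<close> itself is located as the zero of the discriminant.
\<close>

section \<open>Counting trees by protection number\<close>

lemma root_leaf_path_leaf_iff: "root_leaf_path (Node {#}) l \<longleftrightarrow> l = 0"
  by (auto elim: root_leaf_path.cases intro: root_leaf_path.leaf)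

lemma protection_number_leaf [simp]: "protection_number (Node {#}) = 0"
  by (simp add: protection_number_def root_leaf_path_leaf_iff)

lemma le_protection_number_iff:
  "k \<le> protection_number t \<longleftrightarrow> (\<forall>l. root_leaf_path t l \<longrightarrow> k \<le> l)"
  unfolding protection_number_def
  by (metis LeastI Least_le ex_root_leaf_path order_trans)

lemma Suc_le_protection_number_branch:
  "Suc k \<le> protection_number (Node {#a, b#}) \<longleftrightarrow>
     k \<le> protection_number a \<and> k \<le> protection_number b"
proof -
  have "root_leaf_path (Node {#a, b#}) l \<longleftrightarrow> (\<exists>l'. l = Suc l' \<and> (root_leaf_path a l' \<or> root_leaf_path b l'))"
    for l by (auto elim!: root_leaf_path.cases[of "Node _"] intro: root_leaf_path.step)
  then show ?thesis unfolding le_protection_number_iff by auto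
qed

text \<open>
  Joining the two members of an ordered pair below a new root produces each non-plane tree twice,
  except for a tree with two equal subtrees, which arises once; adding the diagonal pairs corrects
  for this.
\<close>

lemma card_unordered_pairs:
  fixes A :: "('a \<times> 'a) set"
  assumes "finite A" and sym: "\<And>a b. (a, b) \<in> A \<Longrightarrow> (b, a) \<in> A"
  shows "2 * card ((\<lambda>(a, b). {#a, b#}) ` A) = card A + card {a. (a, a) \<in> A}"
proof -
  define f :: "'a \<times> 'a \<Rightarrow> 'a multiset" where "f = (\<lambda>(a, b). {#a, b#})"
  define D where "D = {p \<in> A. fst p = snd p}"
  have "bij_betw (\<lambda>a. (a, a)) {a. (a, a) \<in> A} D"
    by (auto simp: bij_betw_def inj_on_def D_def image_iff)
  then have D: "card {a. (a, a) \<in> A} = card D"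
    by (rule bij_betw_same_card)
  have "finite D" using assms(1) by (auto simp: D_def)
  have fiber: "card {p \<in> A. f p = u} + card {p \<in> D. f p = u} = 2" if "u \<in> f ` A" for u
  proof -
    from that obtain a b where ab: "(a, b) \<in> A" "u = {#a, b#}"
      by (auto simp: f_def)
    then have A: "{p \<in> A. f p = u} = {(a, b), (b, a)}"
      using sym by (auto simp: f_def add_eq_conv_diff)
    have D: "{p \<in> D. f p = u} = (if a = b then {(a, a)} else {})"
      using ab by (auto simp: D_def f_def add_eq_conv_diff)
    show ?thesis unfolding A D by auto
  qed
  have "card A + card D = (\<Sum>u\<in>f ` A. card {p \<in> A. f p = u} + card {p \<in> D. f p = u})"
  proof -
    have "D \<subseteq> A" by (auto simp: D_def)
    have "card A = (\<Sum>u\<in>f ` A. card {p \<in> A. f p = u})"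
      using sum.group[of A "f ` A" f "\<lambda>_. 1::nat"] assms(1) by simp
    moreover have "card D = (\<Sum>u\<in>f ` A. card {p \<in> D. f p = u})"
      using sum.group[of D "f ` A" f "\<lambda>_. 1::nat"] \<open>finite D\<close> assms(1) \<open>D \<subseteq> A\<close>
      by (simp add: image_mono)
    ultimately show ?thesis by (simp add: sum.distrib)
  qed
  also have "\<dots> = (\<Sum>u\<in>f ` A. 2)"
    using fiber by (intro sum.cong) auto
  finally show ?thesis using D by (simp add: f_def)
qed

abbreviation w :: "nat \<Rightarrow> nat \<Rightarrow> real" where
  "w k n \<equiv> fps_nth (T_prot k) n"

definition protected_trees :: "nat \<Rightarrow> nat \<Rightarrow> rtree set" where
  "protected_trees k n = {t \<in> binary_trees n. k \<le> protection_number t}"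

lemma w_eq_card: "w k n = real (card (protected_trees k n))"
  by (simp add: T_prot_def protected_trees_def)

lemma finite_protected_trees [simp]: "finite (protected_trees k n)"
  using finite_binary_trees[of n] by (simp add: protected_trees_def)

lemma T_eq_T_prot_0: "T = T_prot 0"
  by (simp add: T_def T_prot_def)

lemma w_nonneg [simp]: "0 \<le> w k n"
  by (simp add: w_eq_card)

lemma binary_trees_0: "binary_trees 0 = {Node {#}}"
  using is_binary_leaf by (auto simp: binary_trees_def internal_vertices_0_iff)

lemma protected_trees_Suc_eq:
  "protected_trees (Suc k) (Suc n) =
     (\<lambda>M. Node M) ` (\<lambda>(a, b). {#a, b#}) ` (\<Union>i\<le>n. protected_trees k i \<times> protected_trees k (n - i))"
  (is "?L = ?R")
proof
  show "?L \<subseteq> ?R"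
  proof
    fix t assume t: "t \<in> ?L"
    then have "is_binary t" "t \<noteq> Node {#}"
      by (auto simp: protected_trees_def binary_trees_def)
    then obtain a b where ab: "t = Node {#a, b#}" "is_binary a" "is_binary b"
      by (metis is_binary_cases)
    have "(a, b) \<in> (\<Union>i\<le>n. protected_trees k i \<times> protected_trees k (n - i))"
      using t ab
      by (auto simp: protected_trees_def binary_trees_def Suc_le_protection_number_branch
          intro!: exI[of _ "internal_vertices a"])
    then show "t \<in> ?R" unfolding ab(1) by (intro imageI image_eqI[where x = "(a, b)"]) auto
  qed
  show "?R \<subseteq> ?L"
    using is_binary_branch
    by (auto simp: protected_trees_def binary_trees_def Suc_le_protection_number_branch)
qed

lemma w_Suc_Suc:
  "w (Suc k) (Suc n) =
     ((\<Sum>i\<le>n. w k i * w k (n - i)) + (if even n then w k (n div 2) else 0)) / 2"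
proof -
  define A where "A = (\<Union>i\<le>n. protected_trees k i \<times> protected_trees k (n - i))"
  have mem: "a \<in> protected_trees k i \<longleftrightarrow> a \<in> protected_trees k (internal_vertices a) \<and>
    i = internal_vertices a" for a i
    by (auto simp: protected_trees_def binary_trees_def)
  have "finite A" by (simp add: A_def)
  have sym: "(b, a) \<in> A" if "(a, b) \<in> A" for a b
  proof -
    from that obtain i where "i \<le> n" "a \<in> protected_trees k i" "b \<in> protected_trees k (n - i)"
      by (auto simp: A_def)
    then show ?thesis unfolding A_def by (intro UN_I[of "n - i"]) auto
  qed
  have "card A = (\<Sum>i\<le>n. card (protected_trees k i) * card (protected_trees k (n - i)))"
  proof -
    have "card A = (\<Sum>i\<le>n. card (protected_trees k i \<times> protected_trees k (n - i)))"
      unfolding A_def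
    proof (intro card_UN_disjoint ballI impI)
      fix i j :: nat assume "i \<noteq> j"
      then show "(protected_trees k i \<times> protected_trees k (n - i)) \<inter>
        (protected_trees k j \<times> protected_trees k (n - j)) = {}"
        by (auto simp: protected_trees_def binary_trees_def)
    qed auto
    then show ?thesis by (simp add: card_cartesian_product)
  qed
  moreover have "{a. (a, a) \<in> A} = (if even n then protected_trees k (n div 2) else {})"
  proof -
    have "(a, a) \<in> A \<longleftrightarrow> even n \<and> a \<in> protected_trees k (n div 2)" for a
    proof
      assume "(a, a) \<in> A"
      then obtain i where i: "i \<le> n" "a \<in> protected_trees k i" "a \<in> protected_trees k (n - i)"
        by (auto simp: A_def)
      then have "n = 2 * i" using mem[of a i] mem[of a "n - i"] by linarith
      then show "even n \<and> a \<in> protected_trees k (n div 2)" using i by simp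
    next
      assume "even n \<and> a \<in> protected_trees k (n div 2)"
      then show "(a, a) \<in> A" unfolding A_def by (auto intro!: UN_I[of "n div 2"] elim!: evenE)
    qed
    then show ?thesis by auto
  qed
  moreover have "card (protected_trees (Suc k) (Suc n)) = card ((\<lambda>(a, b). {#a, b#}) ` A)"
    unfolding protected_trees_Suc_eq A_def[symmetric] by (rule card_image) (auto simp: inj_on_def)
  ultimately have "2 * card (protected_trees (Suc k) (Suc n)) =
    (\<Sum>i\<le>n. card (protected_trees k i) * card (protected_trees k (n - i))) +
    (if even n then card (protected_trees k (n div 2)) else 0)"
    using card_unordered_pairs[OF \<open>finite A\<close> sym] by simp
  from arg_cong[OF this, of real] show ?thesis
    by (simp add: w_eq_card split: if_splits)
qed

lemma w_0_0 [simp]: "w 0 0 = 1"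
  by (simp add: T_prot_def binary_trees_0)

lemma w_Suc_0 [simp]: "w (Suc k) 0 = 0"
  by (auto simp: w_eq_card protected_trees_def binary_trees_0)

lemma w_1_Suc: "w 1 (Suc n) = w 0 (Suc n)"
proof -
  have "protected_trees 1 (Suc n) = protected_trees 0 (Suc n)"
  proof -
    have "1 \<le> protection_number t" if t: "t \<in> binary_trees (Suc n)" for t
    proof -
      from t have "is_binary t" "t \<noteq> Node {#}"
        by (auto simp: binary_trees_def)
      then obtain a b where "t = Node {#a, b#}"
        by (metis is_binary_cases)
      then show ?thesis
        using Suc_le_protection_number_branch[of 0 a b] by simp
    qed
    then show ?thesis by (auto simp: protected_trees_def)
  qed
  then show ?thesis by (simp add: w_eq_card)
qed

lemma w_0_Suc:
  "w 0 (Suc n) =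
     ((\<Sum>i\<le>n. w 0 i * w 0 (n - i)) + (if even n then w 0 (n div 2) else 0)) / 2"
  using w_Suc_Suc[of 0 n] w_1_Suc[of n] by simp

lemma w_antimono: "j \<le> k \<Longrightarrow> w k n \<le> w j n"
  unfolding w_eq_card by (auto simp: protected_trees_def intro!: card_mono finite_binary_trees)

lemma w_0_ge_1: "1 \<le> w 0 n"
  using binary_trees_nonempty[of n] finite_binary_trees[of n]
  by (simp add: w_eq_card protected_trees_def Suc_le_eq card_gt_0_iff)

lemma w_0_pos [simp]: "0 < w 0 n"
  using w_0_ge_1[of n] by linarith

lemma w_0_neq_0 [simp]: "w 0 n \<noteq> 0"
  using w_0_pos[of n] by linarith

text \<open>
  Hanging a leaf next to a tree with \<open>n\<close> internal vertices is injective and produces trees with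
  protection number exactly 1. This keeps a fixed proportion of all trees out of the tail from 2
  on, which starts the geometric bound on the tails.
\<close>

lemma w_2_le: "w 2 (Suc n) \<le> w 0 (Suc n) - w 0 n"
proof -
  define f where "f = (\<lambda>t. Node {#t, Node {#}#})"
  have "inj f" by (auto simp: inj_def f_def)
  have prot: "\<not> 2 \<le> protection_number (f t)" for t
    using Suc_le_protection_number_branch[of 1 t "Node {#}"] by (simp add: f_def numeral_2_eq_2)
  have "f ` protected_trees 0 n \<subseteq> protected_trees 0 (Suc n)"
    using is_binary_branch is_binary_leaf by (auto simp: protected_trees_def binary_trees_def f_def)
  moreover have "protected_trees 2 (Suc n) \<subseteq> protected_trees 0 (Suc n)"
    by (auto simp: protected_trees_def)
  moreover have "protected_trees 2 (Suc n) \<inter> f ` protected_trees 0 n = {}"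
    using prot by (auto simp: protected_trees_def)
  ultimately have "card (protected_trees 2 (Suc n)) + card (f ` protected_trees 0 n)
      \<le> card (protected_trees 0 (Suc n))"
    by (subst card_Un_disjoint[symmetric]) (auto intro!: card_mono)
  moreover have "card (f ` protected_trees 0 n) = card (protected_trees 0 n)"
    using \<open>inj f\<close> by (intro card_image) (auto simp: inj_on_def)
  ultimately show ?thesis by (simp add: w_eq_card)
qed

section \<open>The generating functions on the positive axis\<close>

abbreviation F :: "nat \<Rightarrow> real \<Rightarrow> real" where
  "F k x \<equiv> eval_fps (T_prot k) x"

abbreviation T_converges :: "real \<Rightarrow> bool" where
  "T_converges x \<equiv> summable (\<lambda>n. w 0 n * x ^ n)"

lemma T_converges_mono: "T_converges y \<Longrightarrow> 0 \<le> x \<Longrightarrow> x \<le> y \<Longrightarrow> T_converges x"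
  by (rule summable_comparison_test) (auto intro!: exI[of _ 0] mult_left_mono power_mono)

lemma T_converges_square: "T_converges x \<Longrightarrow> 0 \<le> x \<Longrightarrow> x \<le> 1 \<Longrightarrow> T_converges (x\<^sup>2)"
  by (rule T_converges_mono) (auto simp: power2_eq_square mult_left_le)

lemma summable_w: "T_converges x \<Longrightarrow> 0 \<le> x \<Longrightarrow> summable (\<lambda>n. w k n * x ^ n)"
  by (rule summable_comparison_test) (auto intro!: exI[of _ 0] mult_right_mono w_antimono)

lemma F_sums: "T_converges x \<Longrightarrow> 0 \<le> x \<Longrightarrow> (\<lambda>n. w k n * x ^ n) sums F k x"
  using summable_w by (simp add: eval_fps_def summable_sums)

lemma F_nonneg: "T_converges x \<Longrightarrow> 0 \<le> x \<Longrightarrow> 0 \<le> F k x"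
  by (rule sums_le[OF _ sums_zero F_sums]) auto

lemma F_mono: "T_converges y \<Longrightarrow> 0 \<le> x \<Longrightarrow> x \<le> y \<Longrightarrow> F k x \<le> F k y"
  using T_converges_mono[of y x] by (intro sums_le[OF _ F_sums F_sums] mult_left_mono power_mono) auto

lemma F_antimono: "T_converges x \<Longrightarrow> 0 \<le> x \<Longrightarrow> j \<le> k \<Longrightarrow> F k x \<le> F j x"
  by (rule sums_le[OF _ F_sums F_sums]) (auto intro!: mult_right_mono w_antimono)

lemma F_0_ge_1: "T_converges x \<Longrightarrow> 0 \<le> x \<Longrightarrow> 1 \<le> F 0 x"
  using sum_le_suminf[of "\<lambda>n. w 0 n * x ^ n" "{0}"] by (simp add: eval_fps_def)

lemma F_1: "T_converges x \<Longrightarrow> 0 \<le> x \<Longrightarrow> F 1 x = F 0 x - 1"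
proof -
  assume x: "T_converges x" "0 \<le> x"
  have "(\<lambda>n. w 0 (Suc n) * x ^ Suc n) sums (F 0 x - 1)"
    using F_sums[OF x, of 0] by (subst sums_Suc_iff) simp
  moreover have "(\<lambda>n. w 1 (Suc n) * x ^ Suc n) sums F 1 x"
    using F_sums[OF x, of 1] by (subst sums_Suc_iff) simp
  ultimately show "F 1 x = F 0 x - 1"
    unfolding w_1_Suc by (rule sums_unique2[symmetric])
qed

lemma sums_even_terms:
  fixes f :: "nat \<Rightarrow> 'a :: real_normed_algebra_1"
  assumes "(\<lambda>m. f m * (x\<^sup>2) ^ m) sums s"
  shows "(\<lambda>n. (if even n then f (n div 2) else 0) * x ^ n) sums s"
proof -
  let ?h = "\<lambda>n. (if even n then f (n div 2) else 0) * x ^ n"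
  have "(\<lambda>m. ?h (2 * m)) sums s"
    using assms by (simp add: power_mult)
  then show ?thesis
    by (subst (asm) sums_mono_reindex) (auto simp: strict_mono_def elim!: evenE)
qed

text \<open>
  A tree with protection number above \<open>k\<close> is an unordered pair of trees with protection number at
  least \<open>k\<close>; the square counts the ordered pairs and the value at \<open>x\<^sup>2\<close> the diagonal ones.
\<close>

lemma F_Suc:
  assumes "T_converges x" "0 \<le> x" "x \<le> 1"
  shows "F (Suc k) x = x / 2 * ((F k x)\<^sup>2 + F k (x\<^sup>2))"
proof -
  note x2 = T_converges_square[OF assms]
  have "(\<lambda>n. \<Sum>i\<le>n. (w k i * x ^ i) * (w k (n - i) * x ^ (n - i))) sums (F k x * F k x)"
    using F_sums[OF assms(1,2), of k] summable_w[OF assms(1,2), of k] assms(2)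
    unfolding eval_fps_def
    by (intro Cauchy_product_sums) (auto simp: abs_mult)
  then have "(\<lambda>n. (\<Sum>i\<le>n. w k i * w k (n - i)) * x ^ n) sums (F k x * F k x)"
    by (rule sums_cong[THEN iffD1, rotated])
      (auto simp: sum_distrib_right intro!: sum.cong simp flip: power_add)
  from sums_mult[OF sums_add[OF this sums_even_terms[OF F_sums[OF x2, of k]]], of "x / 2"]
  have "(\<lambda>n. w (Suc k) (Suc n) * x ^ Suc n) sums (x / 2 * ((F k x)\<^sup>2 + F k (x\<^sup>2)))"
    by (simp add: w_Suc_Suc power2_eq_square field_simps)
  moreover have "(\<lambda>n. w (Suc k) (Suc n) * x ^ Suc n) sums F (Suc k) x"
    using F_sums[OF assms(1,2), of "Suc k"] by (subst sums_Suc_iff) simp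
  ultimately show ?thesis by (rule sums_unique2[symmetric])
qed

lemma F_0_eq:
  assumes "T_converges x" "0 \<le> x" "x \<le> 1"
  shows "F 0 x = 1 + x / 2 * ((F 0 x)\<^sup>2 + F 0 (x\<^sup>2))"
  using F_Suc[OF assms, of 0] F_1[OF assms(1,2)] by simp

text \<open>
  Truncation turns the functional equation into an inequality that holds whether or not the series
  converges at \<open>x\<close>, so that it can be used to prove convergence.
\<close>

lemma sum_T_Suc_le:
  assumes "0 \<le> x"
  shows "(\<Sum>n<Suc N. w 0 n * x ^ n) \<le>
    1 + x / 2 * ((\<Sum>n<N. w 0 n * x ^ n)\<^sup>2 + (\<Sum>n<N. w 0 n * (x\<^sup>2) ^ n))"
proof -
  define a where "a n = w 0 n * x ^ n" for n
  have a: "0 \<le> a n" for n using assms by (simp add: a_def)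
  have conv: "(\<Sum>n<N. \<Sum>i\<le>n. a i * a (n - i)) \<le> (\<Sum>n<N. a n)\<^sup>2"
  proof -
    have "(\<Sum>n<N. \<Sum>i\<le>n. a i * a (n - i)) = (\<Sum>(i, j)\<in>{(i, j). i + j < N}. a i * a j)"
      by (rule sum.triangle_reindex[symmetric])
    also have "\<dots> \<le> (\<Sum>(i, j)\<in>{..<N} \<times> {..<N}. a i * a j)"
      using a by (intro sum_mono2) auto
    also have "\<dots> = (\<Sum>n<N. a n)\<^sup>2"
      by (simp add: power2_eq_square sum_product sum.cartesian_product)
    finally show ?thesis .
  qed
  have diag: "(\<Sum>n<N. (if even n then w 0 (n div 2) else 0) * x ^ n) \<le> (\<Sum>n<N. w 0 n * (x\<^sup>2) ^ n)"
  proof -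
    let ?f = "\<lambda>n. if n < N then w 0 n else 0"
    have "(\<lambda>n. ?f n * (x\<^sup>2) ^ n) sums (\<Sum>n<N. ?f n * (x\<^sup>2) ^ n)"
      by (rule sums_finite) auto
    from sums_even_terms[OF this]
    have s: "(\<lambda>n. (if even n then ?f (n div 2) else 0) * x ^ n) sums (\<Sum>n<N. ?f n * (x\<^sup>2) ^ n)" .
    have "(\<Sum>n<N. (if even n then w 0 (n div 2) else 0) * x ^ n) =
        (\<Sum>n<N. (if even n then ?f (n div 2) else 0) * x ^ n)"
      by (rule sum.cong) auto
    also have "\<dots> \<le> (\<Sum>n<N. ?f n * (x\<^sup>2) ^ n)"
      using sum_le_suminf[OF sums_summable[OF s], of "{..<N}"] assms
      by (simp add: sums_unique[OF s, symmetric])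
    also have "\<dots> = (\<Sum>n<N. w 0 n * (x\<^sup>2) ^ n)"
      by (rule sum.cong) auto
    finally show ?thesis .
  qed
  have "(\<Sum>n<Suc N. w 0 n * x ^ n) = 1 + (\<Sum>n<N. w 0 (Suc n) * x ^ Suc n)"
    by (subst sum.lessThan_Suc_shift) simp
  also have "(\<Sum>n<N. w 0 (Suc n) * x ^ Suc n) =
      x / 2 * ((\<Sum>n<N. \<Sum>i\<le>n. a i * a (n - i)) +
        (\<Sum>n<N. (if even n then w 0 (n div 2) else 0) * x ^ n))"
  proof -
    have "w 0 (Suc n) * x ^ Suc n = x / 2 * ((\<Sum>i\<le>n. a i * a (n - i)) +
        (if even n then w 0 (n div 2) else 0) * x ^ n)" for n
    proof -
      have "(\<Sum>i\<le>n. a i * a (n - i)) = (\<Sum>i\<le>n. w 0 i * w 0 (n - i)) * x ^ n"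
        by (auto simp: a_def sum_distrib_right simp flip: power_add intro!: sum.cong)
      then show ?thesis by (simp add: w_0_Suc field_simps)
    qed
    then show ?thesis by (simp only: sum.distrib flip: sum_distrib_left)
  qed
  also have "\<dots> \<le> x / 2 * ((\<Sum>n<N. a n)\<^sup>2 + (\<Sum>n<N. w 0 n * (x\<^sup>2) ^ n))"
    using conv diag assms by (intro mult_left_mono add_mono) auto
  finally show ?thesis by (simp add: a_def)
qed

lemma T_converges_and_leI:
  assumes "0 \<le> x" and "\<And>N. (\<Sum>n<N. w 0 n * x ^ n) \<le> b"
  shows "T_converges x \<and> F 0 x \<le> b"
proof -
  have "T_converges x"
    by (rule bounded_imp_summable[of _ b])
      (use assms(2)[of "Suc _"] assms(1) in \<open>auto simp: lessThan_Suc_atMost\<close>)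
  moreover from this have "F 0 x \<le> b"
    unfolding eval_fps_def using assms(2) by (rule suminf_le_const)
  ultimately show ?thesis by simp
qed

text \<open>
  By induction, a supersolution of the functional equation at \<open>x\<close> stays above every partial sum.
  Hence it proves convergence at \<open>x\<close> and bounds the value there at the same time.
\<close>

lemma T_supersolution:
  assumes "0 \<le> x" "T_converges (x\<^sup>2)" "F 0 (x\<^sup>2) \<le> s" "1 + x / 2 * (b\<^sup>2 + s) \<le> b"
  shows "T_converges x \<and> F 0 x \<le> b"
proof (rule T_converges_and_leI)
  have "0 \<le> s" using assms(2,3) F_nonneg[of "x\<^sup>2" 0] by auto
  then have "0 \<le> x / 2 * (b\<^sup>2 + s)" using assms(1) by simp
  then have "0 \<le> b" using assms(4) by linarith
  show "(\<Sum>n<N. w 0 n * x ^ n) \<le> b" for N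
  proof (induction N)
    case (Suc N)
    have "(\<Sum>n<N. w 0 n * (x\<^sup>2) ^ n) \<le> F 0 (x\<^sup>2)"
      unfolding eval_fps_def using assms(2) by (intro sum_le_suminf) auto
    then have "(\<Sum>n<N. w 0 n * (x\<^sup>2) ^ n) \<le> s" using assms(3) by simp
    moreover have "(\<Sum>n<N. w 0 n * x ^ n)\<^sup>2 \<le> b\<^sup>2"
      using Suc assms(1) by (intro power_mono) (auto intro!: sum_nonneg)
    ultimately have "1 + x / 2 * ((\<Sum>n<N. w 0 n * x ^ n)\<^sup>2 + (\<Sum>n<N. w 0 n * (x\<^sup>2) ^ n))
        \<le> 1 + x / 2 * (b\<^sup>2 + s)"
      using assms(1) by (intro add_left_mono mult_left_mono add_mono) auto
    then show ?case using sum_T_Suc_le[OF assms(1), of N] assms(4) by linarith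
  qed (use \<open>0 \<le> b\<close> in simp)
qed (fact assms(1))

text \<open>
  The same induction with \<open>F 0 (x\<^sup>2) \<le> F 0 x\<close> in place of a bound at \<open>x\<^sup>2\<close>. It refers to no other
  argument and so provides the first convergence statement; at a tiny argument it also gives the
  first numerical bound, from which bounds at the successive square roots follow.
\<close>

lemma T_supersolution_crude:
  assumes "0 \<le> x" "x \<le> 1" "0 \<le> b" "1 + x / 2 * (b\<^sup>2 + b) \<le> b"
  shows "T_converges x \<and> F 0 x \<le> b"
proof (rule T_converges_and_leI)
  show "(\<Sum>n<N. w 0 n * x ^ n) \<le> b" for N
  proof (induction N)
    case (Suc N)
    have "(\<Sum>n<N. w 0 n * (x\<^sup>2) ^ n) \<le> (\<Sum>n<N. w 0 n * x ^ n)"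
      using assms(1,2) by (intro sum_mono mult_left_mono power_mono)
        (auto simp: power2_eq_square mult_left_le)
    then have "(\<Sum>n<N. w 0 n * (x\<^sup>2) ^ n) \<le> b" using Suc by simp
    moreover have "(\<Sum>n<N. w 0 n * x ^ n)\<^sup>2 \<le> b\<^sup>2"
      using Suc assms(1) by (intro power_mono) (auto intro!: sum_nonneg)
    ultimately have "1 + x / 2 * ((\<Sum>n<N. w 0 n * x ^ n)\<^sup>2 + (\<Sum>n<N. w 0 n * (x\<^sup>2) ^ n))
        \<le> 1 + x / 2 * (b\<^sup>2 + b)"
      using assms(1) by (intro add_left_mono mult_left_mono add_mono) auto
    then show ?case using sum_T_Suc_le[OF assms(1), of N] assms(4) by linarith
  qed (use assms(3) in simp)
qed (fact assms(1))

text \<open>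
  \<open>F 0 x\<close> is a root of the quadratic polynomial given by the functional equation, and that
  polynomial is strictly decreasing up to \<open>1 / x\<close>. A point below \<open>1 / x\<close> where the polynomial is
  still nonnegative therefore lies below the root.
\<close>

lemma T_subsolution:
  assumes x: "T_converges x" "0 \<le> x" "x \<le> 1"
    and s: "s \<le> F 0 (x\<^sup>2)" and a: "a \<le> 1 + x / 2 * (a\<^sup>2 + s)" "x * a \<le> 1"
  shows "a \<le> F 0 x"
proof (rule ccontr)
  assume "\<not> a \<le> F 0 x"
  define y where "y = F 0 x"
  have "y < a" using \<open>\<not> a \<le> F 0 x\<close> by (simp add: y_def)
  have "x / 2 * s \<le> x / 2 * F 0 (x\<^sup>2)" using s x by (intro mult_left_mono) auto
  then have "1 + x / 2 * (y\<^sup>2 + s) \<le> y"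
    using F_0_eq[OF x] by (simp add: y_def algebra_simps)
  then have "a - y \<le> x / 2 * (a\<^sup>2 - y\<^sup>2)" using a by (simp add: algebra_simps)
  also have "\<dots> = (a - y) * (x * (a + y) / 2)" by (simp add: power2_eq_square algebra_simps)
  finally have "(a - y) * 1 \<le> (a - y) * (x * (a + y) / 2)" by simp
  then have "1 \<le> x * (a + y) / 2"
    using \<open>y < a\<close> by (subst (asm) mult_le_cancel_left_pos) auto
  moreover have "x * y < 1" if "x > 0"
  proof -
    have "x * y < x * a" using that \<open>y < a\<close> by simp
    then show ?thesis using a by simp
  qed
  moreover have "x \<noteq> 0" using \<open>1 \<le> x * (a + y) / 2\<close> by auto
  ultimately show False using a x by (simp add: algebra_simps)
qed

section \<open>The dominant singularity\<close>

text \<open>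
  The discriminant of the functional equation, read as a quadratic equation for \<open>F 0 x\<close>. It only
  involves \<open>F 0\<close> at \<open>x\<^sup>2\<close>, so it makes sense beyond \<open>\<rho>\<close>, and \<open>\<rho>\<close> is where it vanishes.
\<close>

definition discriminant :: "real \<Rightarrow> real" where
  "discriminant x = 1 - 2 * x - x\<^sup>2 * F 0 (x\<^sup>2)"

lemma discriminant_eq:
  assumes "T_converges x" "0 \<le> x" "x \<le> 1"
  shows "discriminant x = (1 - x * F 0 x)\<^sup>2"
proof -
  have "2 * x * F 0 x = 2 * x + x\<^sup>2 * ((F 0 x)\<^sup>2 + F 0 (x\<^sup>2))"
    by (subst F_0_eq[OF assms]) (simp add: power2_eq_square algebra_simps)
  then show ?thesis by (simp add: discriminant_def power2_eq_square algebra_simps)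
qed

text \<open>
  If the discriminant is nonnegative, then \<open>1 / x\<close> is a supersolution.
\<close>

lemma T_converges_if_discriminant_nonneg:
  assumes "0 < x" "T_converges (x\<^sup>2)" "discriminant x \<ge> 0"
  shows "T_converges x \<and> F 0 x \<le> 1 / x"
proof (rule T_supersolution)
  have "1 / x - (1 + x / 2 * ((1 / x)\<^sup>2 + F 0 (x\<^sup>2))) = discriminant x / (2 * x)"
    using assms(1) by (simp add: discriminant_def add_divide_distrib diff_divide_distrib
        power2_eq_square distrib_left)
  also have "\<dots> \<ge> 0" using assms by simp
  finally show "1 + x / 2 * ((1 / x)\<^sup>2 + F 0 (x\<^sup>2)) \<le> 1 / x" by simp
qed (use assms in auto)

lemma not_T_converges_1: "\<not> T_converges 1"
proof
  assume "T_converges 1"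
  then have "(\<lambda>n. w 0 n) \<longlonglongrightarrow> 0" by (auto dest: summable_LIMSEQ_zero)
  then have "1 \<le> (0 :: real)" by (rule tendsto_lowerbound) (auto simp: w_0_ge_1)
  then show False by simp
qed

lemma conv_radius_T: "fps_conv_radius T = ereal \<rho>" and rho_ge: "1 / 4 \<le> \<rho>"
proof -
  have "T_converges (1 / 4)"
    using T_supersolution_crude[of "1 / 4" 2] by simp
  then have lb: "ereal (1 / 4) \<le> fps_conv_radius T"
    unfolding fps_conv_radius_def T_eq_T_prot_0
    using conv_radius_geI[of "w 0" "1 / 4 :: real"] by simp
  have ub: "fps_conv_radius T \<le> 1"
    unfolding fps_conv_radius_def T_eq_T_prot_0
    using not_T_converges_1 conv_radius_leI'[of "w 0" "1 :: real"] by (simp add: one_ereal_def)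
  show "fps_conv_radius T = ereal \<rho>"
    using lb ub unfolding \<rho>_def by (cases "fps_conv_radius T") (auto simp: one_ereal_def)
  with lb show "1 / 4 \<le> \<rho>" by simp
qed

lemma rho_pos [simp]: "0 < \<rho>"
  using rho_ge by simp

lemma rho_nonneg [simp]: "0 \<le> \<rho>"
  by (rule less_imp_le) simp

lemma T_converges_less: "0 \<le> x \<Longrightarrow> x < \<rho> \<Longrightarrow> T_converges x"
  using conv_radius_T unfolding fps_conv_radius_def T_eq_T_prot_0
  by (intro summable_in_conv_radius) auto

lemma T_converges_le: "0 \<le> x \<Longrightarrow> T_converges x \<Longrightarrow> x \<le> \<rho>"
  using conv_radius_geI[of "w 0" x] conv_radius_T
  unfolding fps_conv_radius_def T_eq_T_prot_0 by simp

lemma rho_le_half: "\<rho> \<le> 1 / 2"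
proof (rule dense_le)
  fix y assume "y < \<rho>"
  show "y \<le> 1 / 2"
  proof (cases "y \<le> 1 / 4")
    case False
    define x where "x = min y 1"
    have x: "T_converges x" "0 \<le> x" "x \<le> 1"
      using False \<open>y < \<rho>\<close> by (auto simp: x_def intro!: T_converges_less)
    have "0 \<le> discriminant x" by (simp add: discriminant_eq[OF x])
    moreover have "0 \<le> F 0 (x\<^sup>2)"
      using T_converges_square[OF x] by (rule F_nonneg) simp
    ultimately have "x \<le> 1 / 2" by (simp add: discriminant_def) (smt (verit) zero_le_mult_iff zero_le_power2)
    then show ?thesis by (simp add: x_def min_def split: if_splits)
  qed simp
qed

lemma rho_square_less: "\<rho>\<^sup>2 < \<rho>"
  using rho_le_half rho_pos by (simp add: power2_eq_square)

lemma isCont_discriminant: "isCont discriminant \<rho>"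
proof -
  have "isCont (F 0) (\<rho>\<^sup>2)"
    using rho_square_less conv_radius_T
    by (intro continuous_eval_fps) (auto simp: T_eq_T_prot_0)
  then have "isCont (\<lambda>x. F 0 (x\<^sup>2)) \<rho>"
    by (intro isCont_o2[where f = "\<lambda>x. x\<^sup>2" and g = "F 0"]) auto
  then show ?thesis
    unfolding discriminant_def
    by (intro continuous_intros)
qed

text \<open>
  Below \<open>\<rho>\<close> the discriminant is a square, so by continuity it is nonnegative at \<open>\<rho>\<close>, which gives
  convergence at \<open>\<rho>\<close> itself. If it were positive there, it would be nonnegative slightly to the
  right of \<open>\<rho>\<close> as well, and the series would converge beyond its radius of convergence. As the
  discriminant is \<open>(1 - \<rho> * F 0 \<rho>)\<^sup>2\<close>, its vanishing determines \<open>F 0 \<rho>\<close>.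
\<close>

lemma discriminant_rho: "discriminant \<rho> = 0"
  and T_converges_rho: "T_converges \<rho>"
  and T_rho: "F 0 \<rho> = 1 / \<rho>"
proof -
  have lim: "(discriminant \<longlongrightarrow> discriminant \<rho>) (at \<rho>)"
    using isCont_discriminant by (simp add: isCont_def)
  have ge: "0 \<le> discriminant \<rho>"
  proof (rule tendsto_lowerbound)
    show "(discriminant \<longlongrightarrow> discriminant \<rho>) (at_left \<rho>)"
      using lim by (rule tendsto_within_subset) simp
    have "eventually (\<lambda>x. 0 < x \<and> x < \<rho>) (at_left \<rho>)"
      using eventually_at_left_real[of 0 \<rho>] by (auto simp: eventually_conj_iff)
    then show "eventually (\<lambda>x. 0 \<le> discriminant x) (at_left \<rho>)"
    proof eventually_elim
      case (elim x)
      then show ?case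
        using discriminant_eq[of x] T_converges_less[of x] rho_le_half by simp
    qed
  qed simp
  have sq: "T_converges (\<rho>\<^sup>2)"
    using rho_square_less by (intro T_converges_less) auto
  show conv: "T_converges \<rho>"
    using T_converges_if_discriminant_nonneg[OF rho_pos sq ge] by simp
  show zero: "discriminant \<rho> = 0"
  proof (rule ccontr)
    assume "discriminant \<rho> \<noteq> 0"
    with ge have pos: "0 < discriminant \<rho>" by simp
    have "eventually (\<lambda>x. 0 < discriminant x) (at_right \<rho>)"
      using order_tendstoD(1)[OF tendsto_within_subset[OF lim] pos] by simp
    moreover have "((\<lambda>x. x\<^sup>2) \<longlongrightarrow> \<rho>\<^sup>2) (at_right \<rho>)"
      by (intro tendsto_intros)
    then have "eventually (\<lambda>x. x\<^sup>2 < \<rho>) (at_right \<rho>)"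
      using rho_square_less by (rule order_tendstoD)
    moreover have "eventually (\<lambda>x. \<rho> < x) (at_right \<rho>)"
      by (rule eventually_at_right_less)
    ultimately have "eventually (\<lambda>x. False) (at_right \<rho>)"
    proof eventually_elim
      case (elim x)
      then have "T_converges x"
        using T_converges_if_discriminant_nonneg[of x] T_converges_less[of "x\<^sup>2"] rho_pos by auto
      then show False using T_converges_le[of x] elim rho_pos by linarith
    qed
    then show False by simp
  qed
  have "(1 - \<rho> * F 0 \<rho>)\<^sup>2 = 0"
    using discriminant_eq[OF conv] zero rho_pos rho_le_half by simp
  then show "F 0 \<rho> = 1 / \<rho>" using rho_pos by (simp add: nonzero_eq_divide_eq[OF less_imp_neq[OF rho_pos, symmetric]] mult.commute del: rho_pos)
qed

section \<open>Square root singularities\<close>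

lemma eventually_mono_imp_bounded:
  fixes e :: "nat \<Rightarrow> real"
  assumes pos: "\<And>n. 0 < e n" and "eventually (\<lambda>n. e n \<le> e (Suc n)) sequentially"
  obtains C where "0 < C" "\<And>m n. m \<le> n \<Longrightarrow> e m \<le> C * e n"
proof -
  from assms(2) obtain N where N: "\<And>n. n \<ge> N \<Longrightarrow> e n \<le> e (Suc n)"
    by (auto simp: eventually_sequentially)
  have inc: "e m \<le> e n" if "N \<le> m" "m \<le> n" for m n
    using that(2) by (induction rule: dec_induct) (use that(1) N order_trans in \<open>force+\<close>)
  define C where "C = Max (insert 1 ((\<lambda>(m, n). e m / e n) ` ({..N} \<times> {..N})))"
  have C1: "1 \<le> C" unfolding C_def by (rule Max_ge) auto
  have C: "e m \<le> C * e n" if "m \<le> N" "n \<le> N" for m n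
  proof -
    have "e m / e n \<le> C" unfolding C_def using that by (intro Max_ge) auto
    then show ?thesis using pos[of n] by (simp add: pos_divide_le_eq)
  qed
  have "e m \<le> C * e n" if "m \<le> n" for m n
  proof (cases "n \<le> N")
    case True
    then show ?thesis using that C by simp
  next
    case False
    have "e (max m N) \<le> e n" using False that by (intro inc) auto
    also have "e m \<le> C * e (max m N)"
    proof (cases "m \<le> N")
      case False
      then show ?thesis using C1 pos[of m] mult_right_mono[of 1 C "e m"] by (simp add: max_def)
    qed (auto simp: max_def intro: C)
    ultimately show ?thesis using C1 by (meson mult_left_mono order_trans zero_le_one)
  qed
  then show thesis using that[of C] C1 by simp
qed

lemma ratio_tendsto_power:
  fixes c :: "nat \<Rightarrow> 'a :: real_normed_field"
  assumes "\<And>n. c n \<noteq> 0" and lim: "(\<lambda>n. c n / c (Suc n)) \<longlonglongrightarrow> r"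
  shows "(\<lambda>n. c (n - k) / c n) \<longlonglongrightarrow> r ^ k"
proof -
  have "(\<lambda>n. c n / c (n + k)) \<longlonglongrightarrow> r ^ k"
  proof (induction k)
    case (Suc k)
    have "(\<lambda>n. c n / c (n + k) * (c (n + k) / c (Suc (n + k)))) \<longlonglongrightarrow> r ^ k * r"
      using LIMSEQ_ignore_initial_segment[OF lim, of k] by (intro tendsto_mult Suc) simp
    then show ?case using assms(1) by (simp add: mult.commute)
  qed (use assms(1) in simp)
  then show ?thesis
    using LIMSEQ_offset[of "\<lambda>n. c (n - k) / c n" k "r ^ k"] by simp
qed

text \<open>
  Multiplying a series whose coefficient ratios tend to \<open>r\<close> by a series with a larger radius of
  convergence multiplies the coefficients asymptotically by the value of the second series at \<open>r\<close>.
  Each term of the convolution has the right limit; the dominating series comes from the fact that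
  \<open>norm (c n) * R ^ n\<close> is eventually increasing.
\<close>

lemma convolution_ratio_tendsto:
  fixes c s :: "nat \<Rightarrow> 'a :: {real_normed_field, banach}"
  assumes nz: "\<And>n. c n \<noteq> 0" and lim: "(\<lambda>n. c n / c (Suc n)) \<longlonglongrightarrow> r"
    and R: "norm r < R" "summable (\<lambda>k. norm (s k) * R ^ k)"
  shows "(\<lambda>n. (\<Sum>k\<le>n. s k * c (n - k)) / c n) \<longlonglongrightarrow> (\<Sum>k. s k * r ^ k)"
proof -
  have "0 < R" using R(1) norm_ge_zero[of r] by linarith
  define e where "e n = norm (c n) * R ^ n" for n
  have "eventually (\<lambda>n. norm (c n / c (Suc n)) < R) sequentially"
    using tendsto_norm[OF lim] R(1) by (rule order_tendstoD)
  then have "eventually (\<lambda>n. e n \<le> e (Suc n)) sequentially"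
  proof eventually_elim
    case (elim n)
    then have "norm (c n) \<le> R * norm (c (Suc n))"
      using nz[of "Suc n"] by (simp add: norm_divide divide_less_eq)
    then have "norm (c n) * R ^ n \<le> (R * norm (c (Suc n))) * R ^ n"
      using \<open>0 < R\<close> by (intro mult_right_mono) auto
    then show ?case by (simp add: e_def mult_ac)
  qed
  moreover have "0 < e n" for n using nz[of n] \<open>0 < R\<close> by (simp add: e_def)
  ultimately obtain C where C: "0 < C" "\<And>m n. m \<le> n \<Longrightarrow> e m \<le> C * e n"
    by (metis eventually_mono_imp_bounded)
  define a where "a k n = (if k \<le> n then s k * c (n - k) / c n else 0)" for k n
  have "(\<lambda>n. \<Sum>k. a k n) \<longlonglongrightarrow> (\<Sum>k. s k * r ^ k)"
  proof (rule tannerys_theorem[where M = "\<lambda>k. C * (norm (s k) * R ^ k)", THEN conjunct2, THEN conjunct2])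
    fix k
    have "(\<lambda>n. s k * (c (n - k) / c n)) \<longlonglongrightarrow> s k * r ^ k"
      by (intro tendsto_intros ratio_tendsto_power nz lim)
    then show "(\<lambda>n. a k n) \<longlonglongrightarrow> s k * r ^ k"
      by (rule Lim_transform_eventually)
        (auto simp: a_def eventually_sequentially intro!: exI[of _ k])
  next
    have "norm (a k n) \<le> C * (norm (s k) * R ^ k)" for k n
    proof (cases "k \<le> n")
      case True
      then have "norm (c (n - k)) * R ^ (n - k) \<le> C * (norm (c n) * R ^ n)"
        using C(2)[of "n - k" n] by (simp add: e_def)
      also have "R ^ n = R ^ k * R ^ (n - k)" using True by (simp flip: power_add)
      finally have "norm (c (n - k)) \<le> C * R ^ k * norm (c n)"
        using \<open>0 < R\<close> by (simp add: mult_ac)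
      then have "norm (c (n - k)) / norm (c n) \<le> C * R ^ k"
        using nz[of n] by (simp add: divide_le_eq)
      then have "norm (s k) * (norm (c (n - k)) / norm (c n)) \<le> norm (s k) * (C * R ^ k)"
        by (rule mult_left_mono) simp
      then show ?thesis using True by (simp add: a_def norm_mult norm_divide mult_ac)
    qed (use C \<open>0 < R\<close> in \<open>simp add: a_def\<close>)
    then show "eventually (\<lambda>(k, n). norm (a k n) \<le> C * (norm (s k) * R ^ k)) (at_top \<times>\<^sub>F sequentially)"
      by (intro always_eventually) auto
  qed (use R(2) in \<open>auto intro: summable_mult\<close>)
  moreover have "(\<Sum>k. a k n) = (\<Sum>k\<le>n. s k * c (n - k)) / c n" for n
    by (subst suminf_finite[of "{..n}"]) (auto simp: a_def sum_divide_distrib)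
  ultimately show ?thesis by simp
qed

text \<open>
  The binomial series of the square root of \<open>1 - z / r\<close>: its coefficients are explicit, never
  vanish and have ratios tending to \<open>r\<close>. It is the model for every square root singularity at \<open>r\<close>.
\<close>

lemma sqrt_linear_fps:
  fixes r :: complex
  assumes "r \<noteq> 0"
  obtains C where "C ^ 2 = 1 - fps_const (1 / r) * fps_X" "\<And>n. fps_nth C n \<noteq> 0"
    "(\<lambda>n. fps_nth C n / fps_nth C (Suc n)) \<longlonglongrightarrow> r"
proof -
  define C where "C = fps_binomial (1 / 2) oo (fps_const (- 1 / r) * fps_X)"
  have nth: "fps_nth C n = (- 1 / r) ^ n * ((1 / 2) gchoose n)" for n
    unfolding C_def by (subst fps_compose_linear) simp
  have "C ^ 2 = fps_binomial 1 oo (fps_const (- 1 / r) * fps_X)"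
    unfolding C_def power2_eq_square
    by (subst fps_compose_mult_distrib[symmetric]) (simp_all flip: fps_binomial_add_mult)
  also have "\<dots> = 1 - fps_const (1 / r) * fps_X"
    by (subst fps_compose_linear) (auto simp: fps_eq_iff fps_binomial_1 fps_X_def)
  finally have C2: "C ^ 2 = 1 - fps_const (1 / r) * fps_X" .
  have half: "1 / 2 \<noteq> (of_nat i :: complex)" for i
  proof
    assume "1 / 2 = (of_nat i :: complex)"
    then have "of_nat 1 = (of_nat (2 * i) :: complex)" by (simp add: field_simps)
    then show False unfolding of_nat_eq_iff by presburger
  qed
  have gb: "((1 / 2) gchoose n) \<noteq> (0 :: complex)" for n
    using half by (simp add: gbinomial_prod_rev)
  then have Cnz: "fps_nth C n \<noteq> 0" for n
    using assms by (simp add: nth)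
  have "fps_nth C n / fps_nth C (Suc n) = - r * (of_nat (Suc n) / (1 / 2 - of_nat n))" for n
  proof -
    have "of_nat (Suc n) * ((1 / 2 :: complex) gchoose (Suc n)) = (1 / 2 - of_nat n) * ((1 / 2) gchoose n)"
      using gbinomial_mult_1[of "1 / 2 :: complex" n] by (simp add: algebra_simps)
    then have "((1 / 2) gchoose n) / ((1 / 2 :: complex) gchoose (Suc n)) = of_nat (Suc n) / (1 / 2 - of_nat n)"
      using gb[of "Suc n"] half[of n] by (simp add: frac_eq_eq mult.commute del: of_nat_Suc)
    moreover have "fps_nth C n / fps_nth C (Suc n) =
        - r * (((1 / 2) gchoose n) / ((1 / 2 :: complex) gchoose (Suc n)))"
      unfolding nth using assms by simp
    ultimately show ?thesis by (simp only:)
  qed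
  moreover have "(\<lambda>n. - r * (of_nat (Suc n) / (1 / 2 - of_nat n))) \<longlonglongrightarrow> - r * (- 1)"
  proof (intro tendsto_intros)
    have "(\<lambda>n. real (Suc n) / (1 / 2 - real n)) \<longlonglongrightarrow> - 1"
      by real_asymp
    from tendsto_of_real[OF this, where 'a = complex]
    show "(\<lambda>n. of_nat (Suc n) / (1 / 2 - of_nat n) :: complex) \<longlonglongrightarrow> - 1"
      by simp
  qed
  ultimately have "(\<lambda>n. fps_nth C n / fps_nth C (Suc n)) \<longlonglongrightarrow> r"
    by simp
  with C2 Cnz show thesis by (rule that)
qed

text \<open>
  Suppose that \<open>G\<close> is analytic beyond the circle of radius \<open>r\<close> and that its only zero in the
  closed disc is a simple one at \<open>r\<close>. Then \<open>G z = (1 - z / r) * h z\<close>, where \<open>h\<close> has no zeros in a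
  slightly larger disc and hence a holomorphic square root there. So a square root of \<open>G\<close> is, up
  to sign, the model series times a series with radius of convergence beyond \<open>r\<close> whose value at
  \<open>r\<close> is not zero, and it inherits the coefficient ratios of the model.
\<close>

lemma sqrt_singularity_ratio:
  fixes A G :: "complex fps" and r :: real
  assumes "0 < r" and AG: "A ^ 2 = G" and rad: "ereal r < fps_conv_radius G"
    and zero: "eval_fps G (of_real r) = 0" and deriv: "eval_fps (fps_deriv G) (of_real r) \<noteq> 0"
    and only: "\<And>z. norm z \<le> r \<Longrightarrow> eval_fps G z = 0 \<Longrightarrow> z = of_real r"
  shows "(\<lambda>n. fps_nth A n / fps_nth A (Suc n)) \<longlonglongrightarrow> of_real r"
proof -
  define \<zeta> :: complex where "\<zeta> = of_real r"
  have \<zeta>: "\<zeta> \<noteq> 0" "norm \<zeta> = r" using \<open>0 < r\<close> by (auto simp: \<zeta>_def)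
  define g where "g = eval_fps G"
  define U where "U = eball (0 :: complex) (fps_conv_radius G)"
  have "open U" by (simp add: U_def)
  have holg: "g holomorphic_on U"
    unfolding g_def U_def by (rule holomorphic_on_eval_fps) auto
  have "\<zeta> \<in> U" using rad \<zeta> by (simp add: U_def in_eball_iff)
  have dg: "deriv g \<zeta> \<noteq> 0"
    using has_field_derivative_eval_fps[of \<zeta> G UNIV] rad \<zeta> deriv
    by (auto simp: g_def \<zeta>_def dest!: DERIV_imp_deriv)
  define h where "h z = - \<zeta> * (if z = \<zeta> then deriv g \<zeta> else (g z - g \<zeta>) / (z - \<zeta>))" for z
  have holh: "h holomorphic_on U"
    unfolding h_def by (intro holomorphic_intros pole_lemma_open holg \<open>open U\<close>)
  have gh: "g z = (1 - z / \<zeta>) * h z" for z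
    using zero \<zeta> by (auto simp: h_def g_def \<zeta>_def[symmetric] field_simps)
  have hnz: "h z \<noteq> 0" if "norm z \<le> r" for z
  proof (cases "z = \<zeta>")
    case True
    then show ?thesis using dg \<zeta> by (simp add: h_def)
  next
    case False
    then show ?thesis using only[OF that] gh[of z] by (auto simp: g_def \<zeta>_def)
  qed
  define V where "V = {z \<in> U. h z \<noteq> 0}"
  have "open V"
  proof -
    have "V = U \<inter> h -` (- {0})" by (auto simp: V_def)
    then show ?thesis
      using continuous_open_preimage[OF holomorphic_on_imp_continuous_on[OF holh] \<open>open U\<close>, of "- {0}"]
      by (simp add: open_Compl)
  qed
  moreover have "cball 0 r \<subseteq> V"
  proof
    fix z :: complex assume "z \<in> cball 0 r"
    then have "norm z \<le> r" by simp
    then have "ereal (norm z) < fps_conv_radius G"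
      using rad by (auto intro: order_le_less_trans[of _ "ereal r"])
    then show "z \<in> V" using hnz \<open>norm z \<le> r\<close> by (simp add: V_def U_def in_eball_iff)
  qed
  ultimately obtain \<epsilon> where \<epsilon>: "0 < \<epsilon>" "(\<Union>z\<in>cball 0 r. ball z \<epsilon>) \<subseteq> V"
    using compact_subset_open_imp_ball_epsilon_subset[OF compact_cball] by metis
  define R where "R = r + \<epsilon>"
  have ball: "ball 0 R \<subseteq> V"
  proof
    fix z :: complex assume z: "z \<in> ball 0 R"
    \<comment> \<open>outside the closed disc, compare \<open>z\<close> with its radial projection onto the circle\<close>
    show "z \<in> V"
    proof (cases "norm z \<le> r")
      case True
      then show ?thesis using \<epsilon> by (force simp: subset_iff)
    next
      case False
      define y where "y = of_real (r / norm z) * z"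
      have nz: "norm z > 0" using False \<open>0 < r\<close> by linarith
      then have "norm y = r" using \<open>0 < r\<close> by (simp add: y_def norm_mult norm_divide)
      have "y - z = of_real (r / norm z - 1) * z" by (simp add: y_def algebra_simps)
      then have "norm (y - z) = \<bar>r / norm z - 1\<bar> * norm z" by (simp only: norm_mult norm_of_real)
      also have "\<dots> = norm z - r" using nz False by (simp add: abs_if field_simps)
      also have "\<dots> < \<epsilon>" using z by (simp add: R_def)
      finally have "z \<in> ball y \<epsilon>" by (simp add: dist_norm)
      then show ?thesis using \<epsilon>(2) \<open>norm y = r\<close> by force
    qed
  qed
  have holR: "h holomorphic_on ball 0 R"
    using holh by (rule holomorphic_on_subset) (use ball in \<open>auto simp: V_def\<close>)
  have "contractible (ball (0 :: complex) R)"
    by (simp add: convex_imp_contractible)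
  with holR obtain s where s: "s holomorphic_on ball 0 R" "\<And>z. z \<in> ball 0 R \<Longrightarrow> h z = s z ^ 2"
    by (rule contractible_imp_holomorphic_sqrt) (use ball in \<open>auto simp: V_def\<close>)
  define S where "S = fps_expansion s 0"
  have holS: "s holomorphic_on eball 0 (ereal R)" using s(1) by simp
  have radS: "ereal R \<le> fps_conv_radius S"
    unfolding S_def by (rule conv_radius_fps_expansion[OF holS])
  have evS: "eval_fps S z = s z" if "norm z < R" for z
    unfolding S_def using eval_fps_expansion'[OF holS, of z] that by simp
  obtain C where C: "C ^ 2 = 1 - fps_const (1 / \<zeta>) * fps_X" "\<And>n. fps_nth C n \<noteq> 0"
    "(\<lambda>n. fps_nth C n / fps_nth C (Suc n)) \<longlonglongrightarrow> \<zeta>"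
    using sqrt_linear_fps[OF \<zeta>(1)] by blast
  define L where "L = 1 - fps_const (1 / \<zeta>) * fps_X"
  have radL: "fps_conv_radius L = \<infinity>"
  proof -
    have "L = fps_of_poly [:1, - 1 / \<zeta>:]"
      by (simp add: L_def fps_of_poly_pCons fps_const_neg[symmetric] del: fps_const_neg)
    then show ?thesis by simp
  qed
  have evL: "eval_fps L z = 1 - z / \<zeta>" for z
  proof -
    have "L = fps_of_poly [:1, - 1 / \<zeta>:]"
      by (simp add: L_def fps_of_poly_pCons fps_const_neg[symmetric] del: fps_const_neg)
    then show ?thesis by simp
  qed
  have "0 < R" using \<open>0 < r\<close> \<epsilon> by (simp add: R_def)
  have radS2: "ereal R \<le> fps_conv_radius (S ^ 2)"
    using radS fps_conv_radius_power[of S 2] by (rule order_trans)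
  have "L * S ^ 2 = G"
  proof (rule eval_fps_eqD)
    have "ereal R \<le> fps_conv_radius (L * S ^ 2)"
      using fps_conv_radius_mult[of L "S ^ 2"] radL radS2 by (auto simp: min_def split: if_splits)
    then show "0 < fps_conv_radius (L * S ^ 2)"
      using \<open>0 < R\<close> by (auto intro: order_less_le_trans[of 0 "ereal R"])
    show "0 < fps_conv_radius G"
      using rad \<open>0 < r\<close> by (auto intro: order_less_trans[of 0 "ereal r"])
    have "eventually (\<lambda>z :: complex. z \<in> ball 0 R) (nhds 0)"
      using \<open>0 < R\<close> by (intro eventually_nhds_in_open) auto
    then show "eventually (\<lambda>z. eval_fps (L * S ^ 2) z = eval_fps G z) (nhds 0)"
    proof eventually_elim
      case (elim z)
      then have z: "norm z < R" by simp
      then have z': "ereal (norm z) < fps_conv_radius S" "ereal (norm z) < fps_conv_radius (S ^ 2)"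
        using radS radS2 by (auto intro: order_less_le_trans[of _ "ereal R"])
      have "eval_fps (L * S ^ 2) z = (1 - z / \<zeta>) * s z ^ 2"
        using z' radL evS[OF z] by (simp add: eval_fps_mult eval_fps_power evL)
      also have "\<dots> = eval_fps G z" using s(2)[OF elim] gh[of z] by (simp add: g_def)
      finally show ?case .
    qed
  qed
  then have "A ^ 2 = (S * C) ^ 2"
    using AG C(1) by (simp add: L_def power_mult_distrib mult.commute)
  then have A: "A = S * C \<or> A = - (S * C)"
    by (simp add: power2_eq_iff)
  define R' where "R' = r + \<epsilon> / 2"
  have "norm \<zeta> < R'" "R' < R" "0 < R'" using \<epsilon> \<zeta> \<open>0 < r\<close> by (auto simp: R'_def R_def)
  have "summable (\<lambda>k. norm (fps_nth S k * of_real R' ^ k))"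
    using radS \<open>R' < R\<close> \<open>0 < R'\<close>
    by (intro norm_summable_fps) (auto intro: order_less_le_trans[of _ "ereal R"])
  then have "summable (\<lambda>k. norm (fps_nth S k) * R' ^ k)"
    using \<open>0 < R'\<close> by (simp add: norm_mult norm_power)
  from convolution_ratio_tendsto[OF C(2,3) \<open>norm \<zeta> < R'\<close> this]
  have lim: "(\<lambda>n. fps_nth (S * C) n / fps_nth C n) \<longlonglongrightarrow> eval_fps S \<zeta>"
    by (simp add: fps_mult_nth eval_fps_def atLeast0AtMost)
  have "eval_fps S \<zeta> \<noteq> 0"
  proof -
    have "norm \<zeta> < R" using \<open>norm \<zeta> < R'\<close> \<open>R' < R\<close> by simp
    then have "h \<zeta> = eval_fps S \<zeta> ^ 2" using s(2)[of \<zeta>] evS[of \<zeta>] by simp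
    then show ?thesis using hnz[of \<zeta>] \<zeta> by auto
  qed
  then have "(\<lambda>n. (fps_nth (S * C) n / fps_nth C n) / (fps_nth (S * C) (Suc n) / fps_nth C (Suc n)) *
      (fps_nth C n / fps_nth C (Suc n))) \<longlonglongrightarrow> eval_fps S \<zeta> / eval_fps S \<zeta> * \<zeta>"
    by (intro tendsto_intros lim LIMSEQ_Suc[OF lim] C(3))
  then have "(\<lambda>n. fps_nth (S * C) n / fps_nth (S * C) (Suc n)) \<longlonglongrightarrow> \<zeta>"
    using C(2) \<open>eval_fps S \<zeta> \<noteq> 0\<close> by simp
  then show ?thesis using A by (auto simp: \<zeta>_def)
qed

section \<open>The ratio of consecutive tree counts\<close>

text \<open>
  Completing the square in the functional equation. The right-hand side contains the coefficients
  of \<open>T\<close> only at \<open>z\<^sup>2\<close>, so its radius of convergence is at least the square root of \<open>\<rho>\<close>, beyond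
  \<open>\<rho>\<close>.
\<close>

lemma fps_functional_equation:
  fixes Tc E :: "complex fps"
  defines "Tc \<equiv> Abs_fps (\<lambda>n. of_real (w 0 n))"
    and "E \<equiv> Abs_fps (\<lambda>n. if even n then of_real (w 0 (n div 2)) else 0)"
  shows "(1 - fps_X * Tc) ^ 2 = 1 - 2 * fps_X - fps_X ^ 2 * E"
proof -
  have eq: "Tc + Tc = 2 + fps_X * (Tc * Tc + E)"
  proof (rule fps_ext)
    fix n
    show "fps_nth (Tc + Tc) n = fps_nth (2 + fps_X * (Tc * Tc + E)) n"
    proof (cases n)
      case 0
      then show ?thesis by (simp add: Tc_def)
    next
      case (Suc m)
      have sq: "fps_nth (Tc * Tc) m = (\<Sum>i\<le>m. of_real (w 0 i * w 0 (m - i)))"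
        by (simp add: Tc_def fps_mult_nth atLeast0AtMost)
      have "w 0 (Suc m) + w 0 (Suc m) =
          (\<Sum>i\<le>m. w 0 i * w 0 (m - i)) + (if even m then w 0 (m div 2) else 0)"
        by (simp add: w_0_Suc)
      from arg_cong[OF this, of complex_of_real]
      have "fps_nth Tc (Suc m) + fps_nth Tc (Suc m) = fps_nth (Tc * Tc) m + fps_nth E m"
        unfolding sq by (auto simp: Tc_def E_def)
      then show ?thesis by (simp add: Suc numeral_fps_const)
    qed
  qed
  have "fps_X * (Tc + Tc) = fps_X * (2 + fps_X * (Tc * Tc + E))"
    by (simp only: eq)
  then show ?thesis by (simp add: power2_eq_square algebra_simps)
qed

lemma discriminant_strict_antimono:
  assumes "0 \<le> x" "x < \<rho>"
  shows "0 < discriminant x"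
proof -
  have "x\<^sup>2 \<le> \<rho>\<^sup>2" using assms by (intro power_mono) auto
  moreover have c: "T_converges (\<rho>\<^sup>2)" using rho_square_less by (intro T_converges_less) auto
  ultimately have "x\<^sup>2 * F 0 (x\<^sup>2) \<le> \<rho>\<^sup>2 * F 0 (\<rho>\<^sup>2)"
    by (intro mult_mono F_mono F_nonneg) (auto intro: T_converges_mono)
  then show ?thesis using discriminant_rho assms unfolding discriminant_def by linarith
qed

text \<open>
  The square root singularity of \<open>T\<close>. The series \<open>1 - z * T z\<close> is a square root of \<open>1 - D z\<close>,
  where \<open>D z = 2 * z + z\<^sup>2 * T (z\<^sup>2)\<close> has nonnegative coefficients and \<open>D \<rho> = 1\<close>. In the closed
  disc of radius \<open>\<rho>\<close> the equation \<open>D z = 1\<close> forces \<open>z\<close> to be a nonnegative real number because of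
  the linear term, and then \<open>z = \<rho>\<close> by monotonicity; the zero is simple because the derivative of
  \<open>D\<close> at \<open>\<rho>\<close> is at least 2.
\<close>

lemma w_0_ratio: "(\<lambda>n. w 0 n / w 0 (Suc n)) \<longlonglongrightarrow> \<rho>"
proof -
  define Tc :: "complex fps" where "Tc = Abs_fps (\<lambda>n. of_real (w 0 n))"
  define e where "e n = (if even n then w 0 (n div 2) else 0)" for n
  define E :: "complex fps" where "E = Abs_fps (\<lambda>n. of_real (e n))"
  define D where "D = 2 * fps_X + fps_X ^ 2 * E"
  define G where "G = 1 - D"
  define A where "A = 1 - fps_X * Tc"
  have E_eq: "E = Abs_fps (\<lambda>n. if even n then of_real (w 0 (n div 2)) else 0)"
    by (auto simp: E_def e_def fps_eq_iff)
  have AG: "A ^ 2 = G"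
    unfolding A_def G_def D_def E_eq Tc_def using fps_functional_equation by (simp add: algebra_simps)
  have E_sums: "(\<lambda>n. e n * x ^ n) sums F 0 (x\<^sup>2)" if "T_converges (x\<^sup>2)" for x
    unfolding e_def by (rule sums_even_terms[OF F_sums[OF that]]) simp
  have sqrt_rho: "\<rho> < sqrt \<rho>"
    using rho_square_less by (simp add: real_less_rsqrt)
  have radE: "ereal (sqrt \<rho>) \<le> fps_conv_radius E"
    unfolding fps_conv_radius_def
  proof (rule conv_radius_geI_ex')
    fix x :: real assume x: "0 < x" "ereal x < ereal (sqrt \<rho>)"
    then have "x\<^sup>2 < \<rho>" using real_less_rsqrt real_sqrt_less_iff[of "x\<^sup>2" \<rho>] by simp
    then have "summable (\<lambda>n. e n * x ^ n)"
      using E_sums[OF T_converges_less] by (auto simp: sums_iff)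
    then show "summable (\<lambda>n. fps_nth E n * of_real x ^ n)"
      unfolding E_def by (simp flip: of_real_power of_real_mult)
  qed
  have radD: "ereal (sqrt \<rho>) \<le> fps_conv_radius D"
  proof -
    have "ereal (sqrt \<rho>) \<le> fps_conv_radius (fps_X ^ 2 * E)"
      using fps_conv_radius_mult[of "fps_X ^ 2" E] radE by (auto simp: min_def split: if_splits)
    moreover have "fps_conv_radius (2 * fps_X :: complex fps) = \<infinity>"
      by (subst numeral_fps_const, subst fps_conv_radius_cmult_left) auto
    ultimately show ?thesis
      unfolding D_def using fps_conv_radius_add[of "2 * fps_X" "fps_X ^ 2 * E"]
      by (auto simp: min_def split: if_splits)
  qed
  have radG: "ereal (sqrt \<rho>) \<le> fps_conv_radius G"
    unfolding G_def using fps_conv_radius_diff[of 1 D] radD by (auto simp: min_def split: if_splits)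
  have rad: "ereal \<rho> < fps_conv_radius G"
    using radG sqrt_rho by (auto intro: order_less_le_trans[of _ "ereal (sqrt \<rho>)"])
  have evG: "eval_fps G z = 1 - (2 * z + z ^ 2 * eval_fps E z)" if "norm z \<le> \<rho>" for z
  proof -
    have lt: "ereal (norm z) < ereal (sqrt \<rho>)" using that sqrt_rho by simp
    note lts = order_less_le_trans[OF lt]
    have 1: "eval_fps (2 * fps_X :: complex fps) z = 2 * z"
      by (subst eval_fps_mult) auto
    have 2: "eval_fps (fps_X ^ 2 * E) z = z ^ 2 * eval_fps E z"
      using lts[OF radE] by (subst eval_fps_mult) auto
    have r1: "fps_conv_radius (2 * fps_X :: complex fps) = \<infinity>"
      by (subst numeral_fps_const, subst fps_conv_radius_cmult_left) auto
    have "ereal (sqrt \<rho>) \<le> fps_conv_radius (fps_X ^ 2 * E)"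
      using fps_conv_radius_mult[of "fps_X ^ 2" E] radE by (auto simp: min_def split: if_splits)
    from lts[OF this] have "eval_fps D z = 2 * z + z ^ 2 * eval_fps E z"
      unfolding D_def by (subst eval_fps_add) (auto simp: r1 1 2)
    then show ?thesis
      unfolding G_def using lts[OF radD] by (subst eval_fps_diff) auto
  qed
  have evE: "eval_fps E (of_real x) = of_real (F 0 (x\<^sup>2))" if "T_converges (x\<^sup>2)" for x
  proof -
    have "(\<lambda>n. of_real (e n * x ^ n) :: complex) sums of_real (F 0 (x\<^sup>2))"
      using E_sums[OF that] by (simp only: sums_of_real_iff)
    then show ?thesis by (simp add: eval_fps_def E_def sums_iff)
  qed
  have conv: "T_converges (x\<^sup>2)" if "0 \<le> x" "x \<le> \<rho>" for x
    using T_converges_square[OF T_converges_mono[OF T_converges_rho that]] that rho_le_half by simp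
  have evG_real: "eval_fps G (of_real x) = of_real (discriminant x)" if "0 \<le> x" "x \<le> \<rho>" for x
    using that by (simp add: evG evE conv discriminant_def algebra_simps)
  have only: "z = of_real \<rho>" if z: "norm z \<le> \<rho>" "eval_fps G z = 0" for z
  proof -
    define x where "x = norm z"
    have x: "0 \<le> x" "x \<le> \<rho>" using z by (auto simp: x_def)
    have "norm (eval_fps E z) \<le> F 0 (x\<^sup>2)"
    proof -
      have s: "(\<lambda>n. e n * x ^ n) sums F 0 (x\<^sup>2)" by (rule E_sums[OF conv[OF x]])
      then have "norm (\<Sum>n. fps_nth E n * z ^ n) \<le> (\<Sum>n. e n * x ^ n)"
        by (intro norm_suminf_le) (auto simp: E_def norm_mult norm_power x_def e_def sums_iff)
      then show ?thesis using s by (simp add: eval_fps_def sums_iff)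
    qed
    then have "norm (z ^ 2 * eval_fps E z) \<le> x\<^sup>2 * F 0 (x\<^sup>2)"
      by (simp add: norm_mult norm_power x_def mult_left_mono)
    then have "Re (z ^ 2 * eval_fps E z) \<le> x\<^sup>2 * F 0 (x\<^sup>2)"
      using complex_Re_le_cmod order_trans by blast
    moreover have "2 * Re z + Re (z ^ 2 * eval_fps E z) = 1"
      using arg_cong[OF evG[OF z(1)], of Re] z(2) by simp
    moreover have "0 \<le> discriminant x"
      using discriminant_strict_antimono[of x] discriminant_rho x by (cases "x = \<rho>") auto
    \<comment> \<open>as \<open>x\<^sup>2 * F 0 (x\<^sup>2) \<le> 1 - 2 * x\<close>\<close>
    ultimately have "x \<le> Re z" by (simp add: discriminant_def)
    then have "Re z = norm z" using complex_Re_le_cmod[of z] by (simp add: x_def)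
    then have "(Im z)\<^sup>2 = 0" using cmod_power2[of z] by simp
    then have zx: "z = of_real x"
      using \<open>Re z = norm z\<close> by (simp add: x_def complex_eq_iff)
    have "discriminant x = 0" using evG_real[OF x] z(2) zx by simp
    then have "x = \<rho>" using discriminant_strict_antimono[of x] x by (cases "x = \<rho>") auto
    then show ?thesis using zx by simp
  qed
  have deriv: "eval_fps (fps_deriv G) (of_real \<rho>) \<noteq> 0"
  proof -
    \<comment> \<open>the coefficients of \<open>- G'\<close>, all nonnegative, with constant term 2\<close>
    define d where "d n = (if n = 0 then 2 else real (Suc n) * e (n - 1))" for n
    have d: "fps_nth (fps_deriv G) n = - of_real (d n)" for n
    proof (cases n)
      case (Suc m)
      have "fps_nth (fps_X\<^sup>2 * E) (Suc (Suc m)) = fps_nth E m"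
        by (subst fps_X_power_mult_nth) auto
      moreover have "fps_nth (2 * fps_X :: complex fps) (Suc (Suc m)) = 0"
        by (simp add: numeral_fps_const)
      ultimately have "fps_nth G (Suc (Suc m)) = - of_real (e m)"
        by (simp add: G_def D_def E_def)
      then show ?thesis unfolding fps_deriv_nth using Suc by (simp add: d_def)
    next
      case 0
      then show ?thesis
        unfolding fps_deriv_nth by (simp add: G_def D_def d_def fps_X_power_mult_nth numeral_fps_const)
    qed
    have "ereal (norm (of_real \<rho> :: complex)) < fps_conv_radius (fps_deriv G)"
      using order_less_le_trans[OF rad fps_conv_radius_deriv] by (simp add: abs_of_pos)
    then have "(\<lambda>n. fps_nth (fps_deriv G) n * of_real \<rho> ^ n) sums eval_fps (fps_deriv G) (of_real \<rho>)"
      by (rule sums_eval_fps)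
    from sums_minus[OF sums_Re[OF this]]
    have "(\<lambda>n. - Re (fps_nth (fps_deriv G) n * of_real \<rho> ^ n)) sums
        - Re (eval_fps (fps_deriv G) (of_real \<rho>))" .
    moreover have "- Re (fps_nth (fps_deriv G) n * of_real \<rho> ^ n) = d n * \<rho> ^ n" for n
      unfolding d by (simp flip: of_real_power)
    ultimately have s: "(\<lambda>n. d n * \<rho> ^ n) sums - Re (eval_fps (fps_deriv G) (of_real \<rho>))"
      by (simp only:)
    have "(\<Sum>n\<in>{0}. d n * \<rho> ^ n) \<le> (\<Sum>n. d n * \<rho> ^ n)"
      using s by (intro sum_le_suminf) (auto simp: sums_iff d_def e_def)
    then have "2 \<le> - Re (eval_fps (fps_deriv G) (of_real \<rho>))"
      using s by (simp add: sums_iff d_def)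
    then show ?thesis by auto
  qed
  have "eval_fps G (of_real \<rho>) = 0"
    using evG_real[of \<rho>] discriminant_rho by simp
  from sqrt_singularity_ratio[OF rho_pos AG rad this deriv only]
  have "(\<lambda>n. fps_nth A (Suc n) / fps_nth A (Suc (Suc n))) \<longlonglongrightarrow> complex_of_real \<rho>"
    by (rule LIMSEQ_Suc)
  then have "(\<lambda>n. complex_of_real (w 0 n / w 0 (Suc n))) \<longlonglongrightarrow> complex_of_real \<rho>"
    by (simp add: A_def Tc_def)
  then show ?thesis by (simp only: tendsto_of_real_iff)
qed

section \<open>Limit law of the protection number\<close>

lemma sum_convolution_split:
  fixes f :: "nat \<Rightarrow> 'a :: comm_ring_1"
  assumes "2 * K \<le> n" and sym: "\<And>i. i \<le> n \<Longrightarrow> f (n - i) = f i"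
  shows "(\<Sum>i\<le>n. f i) = 2 * (\<Sum>i<K. f i) + (\<Sum>i\<in>{K..n - K}. f i)"
proof -
  have "{..n} = {..<K} \<union> ({K..n - K} \<union> {n - K<..n})" using assms by auto
  then have "(\<Sum>i\<le>n. f i) = (\<Sum>i<K. f i) + ((\<Sum>i\<in>{K..n - K}. f i) + (\<Sum>i\<in>{n - K<..n}. f i))"
    using assms(1) by (simp only:) (subst sum.union_disjoint; auto simp: sum.union_disjoint)+
  also have "(\<Sum>i\<in>{n - K<..n}. f i) = (\<Sum>i<K. f i)"
    by (rule sum.reindex_bij_witness[of _ "\<lambda>i. n - i" "\<lambda>i. n - i"]) (use assms in auto)
  finally show ?thesis by simp
qed

text \<open>
  Only the terms near the two ends of the convolution contribute. For \<open>t\<close> itself the two ends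
  account for the whole limit \<open>2 * \<tau>\<close>, so the middle terms of \<open>t\<close> become negligible, and with them
  those of any sequence \<open>a\<close> between 0 and \<open>t\<close>. At each end one factor is a fixed coefficient and
  the other one is asymptotically \<open>\<alpha> * t n\<close> times a power of \<open>r\<close>.
\<close>

lemma convolution_square_ratio_tendsto:
  fixes a t :: "nat \<Rightarrow> real"
  assumes t: "\<And>n. 0 < t n" and a: "\<And>n. 0 \<le> a n" "\<And>n. a n \<le> t n"
    and ratio: "(\<lambda>n. t n / t (Suc n)) \<longlonglongrightarrow> r" and "0 \<le> r"
    and lim: "(\<lambda>n. a n / t n) \<longlonglongrightarrow> \<alpha>"
    and t_sums: "(\<lambda>n. t n * r ^ n) sums \<tau>" and a_sums: "(\<lambda>n. a n * r ^ n) sums \<sigma>"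
    and conv: "(\<lambda>n. (\<Sum>i\<le>n. t i * t (n - i)) / t n) \<longlonglongrightarrow> 2 * \<tau>"
  shows "(\<lambda>n. (\<Sum>i\<le>n. a i * a (n - i)) / t n) \<longlonglongrightarrow> 2 * \<alpha> * \<sigma>"
proof -
  define x where "x n = (\<Sum>i\<le>n. a i * a (n - i)) / t n" for n
  define head where "head b K n = (\<Sum>i<K. b i * b (n - i)) / t n" for b :: "nat \<Rightarrow> real" and K n
  define mid where "mid b K n = (\<Sum>i\<in>{K..n - K}. b i * b (n - i)) / t n" for b :: "nat \<Rightarrow> real" and K n
  have split: "(\<Sum>i\<le>n. b i * b (n - i)) / t n = 2 * head b K n + mid b K n" if "2 * K \<le> n" for b K n
    by (subst sum_convolution_split[OF that]) (auto simp: head_def mid_def add_divide_distrib)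
  have shift: "(\<lambda>n. t (n - i) / t n) \<longlonglongrightarrow> r ^ i" for i
    by (rule ratio_tendsto_power) (use t ratio in \<open>auto simp: less_imp_neq[symmetric]\<close>)
  have head_lim: "(\<lambda>n. head b K n) \<longlonglongrightarrow> \<beta> * (\<Sum>i<K. b i * r ^ i)"
    if "(\<lambda>n. b n / t n) \<longlonglongrightarrow> \<beta>" for b K \<beta>
  proof -
    have "(\<lambda>n. b (n - i) / t n) \<longlonglongrightarrow> \<beta> * r ^ i" for i
    proof -
      have "(\<lambda>n. b (n - i) / t (n - i)) \<longlonglongrightarrow> \<beta>"
        using LIMSEQ_offset[of "\<lambda>n. b (n - i) / t (n - i)" i \<beta>] that by simp
      from tendsto_mult[OF this shift[of i]] show ?thesis
        using t by (simp add: less_imp_neq[symmetric])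
    qed
    then have "(\<lambda>n. \<Sum>i<K. b i * (b (n - i) / t n)) \<longlonglongrightarrow> (\<Sum>i<K. b i * (\<beta> * r ^ i))"
      by (intro tendsto_intros)
    then show ?thesis by (simp add: head_def sum_divide_distrib sum_distrib_left mult_ac)
  qed
  have "(\<lambda>n. t n / t n) \<longlonglongrightarrow> 1" using t by (simp add: less_imp_neq[symmetric])
  note head_t = head_lim[OF this]
  have mid_t: "(\<lambda>n. mid t K n) \<longlonglongrightarrow> 2 * \<tau> - 2 * (1 * (\<Sum>i<K. t i * r ^ i))" for K
  proof -
    have "(\<lambda>n. (\<Sum>i\<le>n. t i * t (n - i)) / t n - 2 * head t K n)
        \<longlonglongrightarrow> 2 * \<tau> - 2 * (1 * (\<Sum>i<K. t i * r ^ i))"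
      by (intro tendsto_intros conv head_t)
    then show ?thesis
      by (rule Lim_transform_eventually)
        (use split[of K] in \<open>auto simp: eventually_sequentially intro!: exI[of _ "2 * K"]\<close>)
  qed
  have "x \<longlonglongrightarrow> 2 * \<alpha> * \<sigma>"
  proof (rule tendstoI)
    fix \<epsilon> :: real assume "0 < \<epsilon>"
    define \<delta> where "\<delta> K = 2 * \<tau> - 2 * (1 * (\<Sum>i<K. t i * r ^ i)) +
      \<bar>2 * (\<alpha> * (\<Sum>i<K. a i * r ^ i)) - 2 * \<alpha> * \<sigma>\<bar>" for K
    have "\<delta> \<longlonglongrightarrow> 2 * \<tau> - 2 * (1 * \<tau>) + \<bar>2 * (\<alpha> * \<sigma>) - 2 * \<alpha> * \<sigma>\<bar>"
      unfolding \<delta>_def using t_sums a_sums unfolding sums_def by (intro tendsto_intros)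
    then have "\<delta> \<longlonglongrightarrow> 0" by simp
    then have "eventually (\<lambda>K. \<delta> K < \<epsilon>) sequentially"
      using \<open>0 < \<epsilon>\<close> by (rule order_tendstoD)
    then obtain K where K: "\<delta> K < \<epsilon>" by (auto simp: eventually_sequentially)
    have "(\<lambda>n. mid t K n + \<bar>2 * head a K n - 2 * \<alpha> * \<sigma>\<bar>) \<longlonglongrightarrow> \<delta> K"
      unfolding \<delta>_def by (intro tendsto_intros mid_t head_lim lim)
    then have "eventually (\<lambda>n. mid t K n + \<bar>2 * head a K n - 2 * \<alpha> * \<sigma>\<bar> < \<epsilon>) sequentially"
      using K by (rule order_tendstoD)
    then show "eventually (\<lambda>n. dist (x n) (2 * \<alpha> * \<sigma>) < \<epsilon>) sequentially"
      using eventually_ge_at_top[of "2 * K"]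
    proof eventually_elim
      case (elim n)
      have "0 \<le> mid a K n" unfolding mid_def
        using a t[of n] by (intro divide_nonneg_nonneg sum_nonneg mult_nonneg_nonneg) (auto simp: less_imp_le)
      moreover have "mid a K n \<le> mid t K n" unfolding mid_def
        using a t by (intro divide_right_mono sum_mono mult_mono) (auto simp: less_imp_le)
      ultimately show ?case
        using elim(1) split[OF elim(2), of a] by (simp add: x_def dist_real_def)
    qed
  qed
  then show ?thesis by (simp add: x_def[abs_def])
qed

lemma w_0_ratio_inverse: "(\<lambda>n. w 0 (Suc n) / w 0 n) \<longlonglongrightarrow> 1 / \<rho>"
  using tendsto_inverse[OF w_0_ratio] rho_pos by (simp add: inverse_eq_divide)

text \<open>
  As the limit of the ratios \<open>w 0 n / w 0 (Suc n)\<close> is less than 1, the tree counts grow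
  exponentially. The trees with two equal branches are therefore asymptotically negligible.
\<close>

lemma w_0_half_negligible: "(\<lambda>n. w 0 (n div 2) / w 0 n) \<longlonglongrightarrow> 0"
proof -
  \<comment> \<open>any number strictly between \<open>\<rho>\<close> and 1, as \<open>\<rho> \<le> 1 / 2\<close>\<close>
  define q :: real where "q = 3 / 4"
  have "eventually (\<lambda>n. w 0 n / w 0 (Suc n) < q) sequentially"
    using w_0_ratio rho_le_half by (intro order_tendstoD(2)[where y = \<rho>]) (auto simp: q_def)
  then have "eventually (\<lambda>n. w 0 n * q ^ n \<le> w 0 (Suc n) * q ^ Suc n) sequentially"
    by eventually_elim (simp add: pos_divide_less_eq mult_ac q_def)
  then obtain C where C: "\<And>m n. m \<le> n \<Longrightarrow> w 0 m * q ^ m \<le> C * (w 0 n * q ^ n)"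
    by (rule eventually_mono_imp_bounded[rotated]) (auto simp: q_def)
  have bound: "w 0 (n div 2) / w 0 n \<le> C * q ^ (n - n div 2)" for n
  proof -
    have "q ^ n = q ^ (n div 2) * q ^ (n - n div 2)" by (simp flip: power_add)
    then have "w 0 (n div 2) * q ^ (n div 2) \<le> (C * q ^ (n - n div 2) * w 0 n) * q ^ (n div 2)"
      using C[of "n div 2" n] by (simp add: mult_ac)
    then have "w 0 (n div 2) \<le> C * q ^ (n - n div 2) * w 0 n"
      by (simp add: q_def)
    then show ?thesis by (simp add: pos_divide_le_eq)
  qed
  have "filterlim (\<lambda>n :: nat. n - n div 2) at_top sequentially"
    unfolding filterlim_at_top eventually_sequentially
  proof (intro allI exI impI)
    fix Z n :: nat assume "2 * Z \<le> n"
    then show "Z \<le> n - n div 2" by linarith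
  qed
  then have "(\<lambda>n. q ^ (n - n div 2)) \<longlonglongrightarrow> 0"
    by (rule filterlim_compose[rotated]) (auto simp: q_def intro!: LIMSEQ_power_zero)
  then have "(\<lambda>n. C * q ^ (n - n div 2)) \<longlonglongrightarrow> C * 0"
    by (intro tendsto_intros)
  then have lim: "(\<lambda>n. C * q ^ (n - n div 2)) \<longlonglongrightarrow> 0"
    by simp
  show ?thesis
    by (rule tendsto_sandwich[OF _ _ tendsto_const lim]) (auto intro!: always_eventually bound)
qed

lemma w_diagonal_negligible:
  "(\<lambda>n. (if even n then w k (n div 2) else 0) / w 0 n) \<longlonglongrightarrow> 0"
  by (rule tendsto_sandwich[OF _ _ tendsto_const w_0_half_negligible])
    (auto intro!: always_eventually divide_right_mono w_antimono)

text \<open>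
  The recurrence expresses the convolution square of the tree counts by the next tree count, so
  its asymptotics follow from those of the ratios; the limit agrees with the hypothesis on \<open>t\<close> of
  the convolution lemma because \<open>F 0 \<rho> = 1 / \<rho>\<close>.
\<close>

lemma w_0_convolution: "(\<lambda>n. (\<Sum>i\<le>n. w 0 i * w 0 (n - i)) / w 0 n) \<longlonglongrightarrow> 2 * F 0 \<rho>"
proof -
  have "(\<Sum>i\<le>n. w 0 i * w 0 (n - i)) / w 0 n =
      2 * (w 0 (Suc n) / w 0 n) - (if even n then w 0 (n div 2) else 0) / w 0 n" for n
    by (simp add: w_0_Suc add_divide_distrib)
  moreover have "(\<lambda>n. 2 * (w 0 (Suc n) / w 0 n) - (if even n then w 0 (n div 2) else 0) / w 0 n)
      \<longlonglongrightarrow> 2 * (1 / \<rho>) - 0"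
    by (intro tendsto_intros w_0_ratio_inverse w_diagonal_negligible)
  ultimately show ?thesis by (simp add: T_rho)
qed

text \<open>
  The factor for \<open>i = 0\<close> equals 1, so for \<open>k \<ge> 1\<close> this is the product over \<open>1 \<le> i < k\<close>. Including
  it makes the recursion uniform in \<open>k\<close>.
\<close>

definition limit_tail :: "nat \<Rightarrow> real" where
  "limit_tail k = (\<Prod>i<k. \<rho> * F i \<rho>)"

lemma w_tail_tendsto: "(\<lambda>n. w k n / w 0 n) \<longlonglongrightarrow> limit_tail k"
proof (induction k)
  case (Suc k)
  have conv: "(\<lambda>n. (\<Sum>i\<le>n. w k i * w k (n - i)) / w 0 n) \<longlonglongrightarrow> 2 * limit_tail k * F k \<rho>"
    by (rule convolution_square_ratio_tendsto[where t = "w 0" and r = \<rho> and \<tau> = "F 0 \<rho>"])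
      (auto intro: w_antimono w_0_ratio Suc F_sums T_converges_rho w_0_convolution less_imp_le)
  have "(\<lambda>n. ((\<Sum>i\<le>n. w k i * w k (n - i)) / w 0 n + (if even n then w k (n div 2) else 0) / w 0 n) / 2 *
      (w 0 n / w 0 (Suc n))) \<longlonglongrightarrow> (2 * limit_tail k * F k \<rho> + 0) / 2 * \<rho>"
    by (intro tendsto_intros conv w_diagonal_negligible w_0_ratio) simp
  moreover have "w (Suc k) (Suc n) / w 0 (Suc n) =
      ((\<Sum>i\<le>n. w k i * w k (n - i)) / w 0 n + (if even n then w k (n div 2) else 0) / w 0 n) / 2 *
      (w 0 n / w 0 (Suc n))" for n
    by (simp add: w_Suc_Suc add_divide_distrib[symmetric])
  ultimately have "(\<lambda>n. w (Suc k) (Suc n) / w 0 (Suc n)) \<longlonglongrightarrow> limit_tail (Suc k)"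
    by (simp add: limit_tail_def mult_ac)
  then show ?case by (rule LIMSEQ_imp_Suc)
qed (simp add: limit_tail_def)

text \<open>
  A bound on the tails that is uniform in the size, for the exchange of limit and summation. Let
  \<open>q0 < 1\<close> bound the tail from 2 on. In the recurrence, the two factors of the convolution
  contribute \<open>q0\<close> and the tail bound for \<open>k\<close>, while the diagonal term contributes the latter only
  once. The diagonal term makes up at most half of the count, so each step gains the factor \<open>(1 +
  q0) / 2\<close>.
\<close>

lemma w_tail_geometric:
  obtains q C where "0 < q" "q < 1" "0 < C" "\<And>k n. w (Suc k) n / w 0 n \<le> C * q ^ k"
proof -
  have "Bseq (\<lambda>n. w 0 (Suc n) / w 0 n)"
    using w_0_ratio_inverse by (intro convergent_imp_Bseq) (auto simp: convergent_def)
  then obtain B where B: "0 < B" "\<And>n. w 0 (Suc n) / w 0 n \<le> B"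
    by (auto simp: Bseq_def)
  define q0 where "q0 = max 0 (1 - 1 / B)"
  define q where "q = (1 + q0) / 2"
  have q0: "0 \<le> q0" "q0 < 1" using B(1) by (auto simp: q0_def)
  have q: "0 < q" "q < 1" using q0 by (auto simp: q_def)
  have w2: "w 2 n \<le> q0 * w 0 n" for n
  proof (cases n)
    case (Suc m)
    have "w 0 (Suc m) \<le> B * w 0 m" using B(2)[of m] by (simp add: pos_divide_le_eq)
    then have "w 0 (Suc m) / B \<le> w 0 m" using B(1) by (simp add: pos_divide_le_eq mult.commute)
    then have "w 2 (Suc m) \<le> (1 - 1 / B) * w 0 (Suc m)"
      using w_2_le[of m] by (simp add: algebra_simps)
    also have "\<dots> \<le> q0 * w 0 (Suc m)" by (intro mult_right_mono) (auto simp: q0_def)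
    finally show ?thesis using Suc by simp
  qed (use q0 in \<open>simp add: numeral_2_eq_2\<close>)
  have w2k: "w (k + 2) n \<le> q0 * w 0 n" for k n
    using w2[of n] w_antimono[of 2 "k + 2" n] by linarith
  have bound: "w (k + 2) n \<le> q ^ k * w 0 n" for k n
  proof (induction k arbitrary: n)
    case 0
    show ?case by (simp add: w_antimono)
  next
    case (Suc k)
    show ?case
    proof (cases n)
      case 0
      then show ?thesis using q by simp
    next
      case (Suc m)
      define S where "S = (\<Sum>i\<le>m. w 0 i * w 0 (m - i))"
      define E where "E = (if even m then w 0 (m div 2) else 0)"
      have "E \<le> S"
      proof (cases "even m")
        case True
        then have "E \<le> w 0 (m div 2) * w 0 (m - m div 2)"
          using mult_left_mono[OF w_0_ge_1[of "m - m div 2"], of "w 0 (m div 2)"] by (simp add: E_def)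
        also have "\<dots> \<le> S" unfolding S_def by (rule member_le_sum) auto
        finally show ?thesis .
      next
        case False
        then show ?thesis by (auto simp: E_def S_def intro!: sum_nonneg)
      qed
      have "(\<Sum>i\<le>m. w (k + 2) i * w (k + 2) (m - i)) \<le> (\<Sum>i\<le>m. (q0 * w 0 i) * (q ^ k * w 0 (m - i)))"
        using w2k Suc.IH q0 q by (intro sum_mono mult_mono) auto
      also have "\<dots> = q ^ k * (q0 * S)" by (simp add: S_def sum_distrib_left mult_ac)
      finally have "w (Suc k + 2) (Suc m) \<le> (q ^ k * (q0 * S) + q ^ k * E) / 2"
        using Suc.IH[of "m div 2"] by (auto simp: w_Suc_Suc E_def)
      also have "\<dots> = q ^ k * ((q0 * S + E) / 2)" by (simp add: algebra_simps)
      also have "\<dots> \<le> q ^ k * (q * ((S + E) / 2))"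
      proof (intro mult_left_mono)
        have "(1 - q0) * E \<le> (1 - q0) * S" using \<open>E \<le> S\<close> q0 by (intro mult_left_mono) auto
        then have "0 \<le> ((1 - q0) * S - (1 - q0) * E) / 4" by simp
        also have "\<dots> = q * ((S + E) / 2) - (q0 * S + E) / 2"
          by (simp add: q_def field_simps)
        finally show "(q0 * S + E) / 2 \<le> q * ((S + E) / 2)"
          by (simp only: diff_ge_0_iff_ge)
      qed (use q in simp)
      also have "(S + E) / 2 = w 0 (Suc m)" by (simp add: w_0_Suc S_def E_def)
      finally show ?thesis using Suc by (simp add: mult_ac)
    qed
  qed
  have "w (Suc k) n / w 0 n \<le> 1 / q * q ^ k" for k n
  proof (cases k)
    case 0
    have "w 1 n / w 0 n \<le> 1" using w_antimono[of 0 1 n] by (simp add: pos_divide_le_eq)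
    also have "1 \<le> 1 / q" using q by simp
    finally show ?thesis using 0 by simp
  next
    case (Suc j)
    have "w (j + 2) n / w 0 n \<le> q ^ j" using bound[of j n] by (simp add: pos_divide_le_eq)
    then show ?thesis using Suc q by simp
  qed
  then show thesis using that[of q "1 / q"] q by simp
qed

lemma expectation_summation_by_parts:
  fixes h :: "nat \<Rightarrow> real"
  assumes "h 0 = 0"
  shows "measure_pmf.expectation (random_binary_tree n) (\<lambda>t. h (protection_number t)) =
    (\<Sum>k. (h (Suc k) - h k) * (w (Suc k) n / w 0 n))"
proof -
  let ?A = "binary_trees n"
  define N where "N = Max (protection_number ` ?A)"
  have N: "protection_number t \<le> N" if "t \<in> ?A" for t
    using that finite_binary_trees[of n] by (simp add: N_def)
  have "(\<Sum>t\<in>?A. h (protection_number t)) =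
      (\<Sum>t\<in>?A. \<Sum>k<N. (h (Suc k) - h k) * (if Suc k \<le> protection_number t then 1 else 0))"
  proof (rule sum.cong[OF refl])
    fix t assume "t \<in> ?A"
    have "h (protection_number t) = (\<Sum>k<protection_number t. h (Suc k) - h k)"
      using assms by (simp add: sum_lessThan_telescope)
    also have "\<dots> = (\<Sum>k<N. (h (Suc k) - h k) * (if Suc k \<le> protection_number t then 1 else 0))"
      by (rule sum.mono_neutral_cong_left) (use N[OF \<open>t \<in> ?A\<close>] in auto)
    finally show "h (protection_number t) = \<dots>" .
  qed
  also have "\<dots> = (\<Sum>k<N. (h (Suc k) - h k) * w (Suc k) n)"
    using finite_binary_trees[of n]
    by (subst sum.swap) (simp add: w_eq_card protected_trees_def sum_distrib_left[symmetric]
        flip: sum.inter_filter)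
  finally have "(\<Sum>t\<in>?A. h (protection_number t)) / w 0 n =
      (\<Sum>k<N. (h (Suc k) - h k) * (w (Suc k) n / w 0 n))"
    by (simp add: sum_divide_distrib)
  also have "\<dots> = (\<Sum>k. (h (Suc k) - h k) * (w (Suc k) n / w 0 n))"
  proof (rule suminf_finite[symmetric])
    fix k assume "k \<notin> {..<N}"
    then have "protected_trees (Suc k) n = {}" using N by (force simp: protected_trees_def)
    then show "(h (Suc k) - h k) * (w (Suc k) n / w 0 n) = 0" by (simp add: w_eq_card)
  qed simp
  finally have "(\<Sum>t\<in>?A. h (protection_number t)) / w 0 n =
      (\<Sum>k. (h (Suc k) - h k) * (w (Suc k) n / w 0 n))" .
  moreover have "w 0 n = real (card ?A)"
    by (simp add: w_eq_card protected_trees_def)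
  moreover have "measure_pmf.expectation (random_binary_tree n) (\<lambda>t. h (protection_number t)) =
      (\<Sum>t\<in>?A. h (protection_number t)) / real (card ?A)"
    unfolding random_binary_tree_def
    by (rule integral_pmf_of_set[OF binary_trees_nonempty finite_binary_trees])
  ultimately show ?thesis by simp
qed

text \<open>
  The growth condition on the increments admits \<open>h k = k\<close> and \<open>h k = k\<^sup>2\<close>, which give mean and
  variance.
\<close>

lemma expectation_tendsto:
  fixes h :: "nat \<Rightarrow> real"
  assumes "h 0 = 0" and bound: "\<And>k. \<bar>h (Suc k) - h k\<bar> \<le> 2 * real (Suc k)"
  shows "summable (\<lambda>k. (h (Suc k) - h k) * limit_tail (Suc k))"
    and "(\<lambda>n. measure_pmf.expectation (random_binary_tree n) (\<lambda>t. h (protection_number t)))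
      \<longlonglongrightarrow> (\<Sum>k. (h (Suc k) - h k) * limit_tail (Suc k))"
proof -
  obtain q C where q: "0 < q" "q < 1" "0 < C" "\<And>k n. w (Suc k) n / w 0 n \<le> C * q ^ k"
    using w_tail_geometric by metis
  have "summable (\<lambda>k. real (Suc k) * q ^ k)"
    using geometric_deriv_sums[of q] q by (simp add: sums_iff)
  then have M: "summable (\<lambda>k. 2 * C * (real (Suc k) * q ^ k))"
    by (rule summable_mult)
  have "norm ((h (Suc k) - h k) * (w (Suc k) n / w 0 n)) \<le> 2 * C * (real (Suc k) * q ^ k)" for k n
  proof -
    have "\<bar>h (Suc k) - h k\<bar> * (w (Suc k) n / w 0 n) \<le> (2 * real (Suc k)) * (C * q ^ k)"
      by (intro mult_mono bound q(4)) auto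
    then show ?thesis by (simp add: abs_mult mult_ac)
  qed
  then have dom: "eventually (\<lambda>(k, n). norm ((h (Suc k) - h k) * (w (Suc k) n / w 0 n))
      \<le> 2 * C * (real (Suc k) * q ^ k)) (at_top \<times>\<^sub>F sequentially)"
    by (intro always_eventually) auto
  have lim: "(\<lambda>n. (h (Suc k) - h k) * (w (Suc k) n / w 0 n))
      \<longlonglongrightarrow> (h (Suc k) - h k) * limit_tail (Suc k)" for k
    by (intro tendsto_intros w_tail_tendsto)
  note * = tannerys_theorem[OF lim dom M sequentially_bot]
  show "summable (\<lambda>k. (h (Suc k) - h k) * limit_tail (Suc k))"
    by (rule summable_norm_cancel) (use * in blast)
  show "(\<lambda>n. measure_pmf.expectation (random_binary_tree n) (\<lambda>t. h (protection_number t)))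
      \<longlonglongrightarrow> (\<Sum>k. (h (Suc k) - h k) * limit_tail (Suc k))"
    unfolding expectation_summation_by_parts[of h, OF assms(1)] using * by blast
qed

section \<open>Numerical enclosures\<close>

text \<open>
  All constants below are decimal fractions with 20 digits after the point, rounded outwards. The
  value of \<open>\<rho>\<close> is enclosed in an interval of four units of the last digit. From it, the values of
  \<open>F 0\<close> at the iterated squares of \<open>\<rho>\<close> are enclosed by super- and subsolutions, descending from \<open>\<rho>
  ^ 32\<close>, and the recurrence for \<open>F\<close> turns the enclosures of \<open>F k\<close> at the powers \<open>\<rho> ^ (2 ^ j)\<close> with
  \<open>j + k \<le> 5\<close> into enclosures of \<open>F (Suc k)\<close> with one power fewer. Every operation is monotone, so
  each bound is obtained from the corresponding bounds of its arguments.
\<close>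

lemma square_bounds:
  fixes x :: real
  assumes "x \<in> {l..u}" "y = x\<^sup>2" "0 \<le> l" "l' \<le> l\<^sup>2" "u\<^sup>2 \<le> u'"
  shows "y \<in> {l'..u'}"
proof -
  have "l\<^sup>2 \<le> x\<^sup>2" "x\<^sup>2 \<le> u\<^sup>2"
    using assms(1,3) by (auto intro!: power_mono)
  then show ?thesis using assms(2,4,5) by simp
qed

lemma T_upper_bound:
  assumes "x \<in> {l..u}" "0 \<le> l" "T_converges y \<and> F 0 y \<le> s" "y = x\<^sup>2" "1 + u / 2 * (b\<^sup>2 + s) \<le> b"
  shows "T_converges x \<and> F 0 x \<le> b"
proof (rule T_supersolution[where s = s])
  have "0 \<le> s" using assms(3,4) F_nonneg[of y 0] by auto
  then have "1 + x / 2 * (b\<^sup>2 + s) \<le> 1 + u / 2 * (b\<^sup>2 + s)"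
    using assms(1) by (intro add_left_mono mult_right_mono) auto
  then show "1 + x / 2 * (b\<^sup>2 + s) \<le> b" using assms(5) by simp
qed (use assms in auto)

lemma T_lower_bound:
  assumes "x \<in> {l..u}" "0 \<le> l" "u \<le> 1" "T_converges x" "s \<le> F 0 y" "y = x\<^sup>2"
    "0 \<le> s" "0 \<le> a" "a \<le> 1 + l / 2 * (a\<^sup>2 + s)" "u * a \<le> 1"
  shows "a \<le> F 0 x"
proof (rule T_subsolution)
  have "1 + l / 2 * (a\<^sup>2 + s) \<le> 1 + x / 2 * (a\<^sup>2 + s)"
    using assms(1,7) by (intro add_left_mono mult_right_mono) auto
  then show "a \<le> 1 + x / 2 * (a\<^sup>2 + s)" using assms(9) by simp
  have "x * a \<le> u * a" using assms(1,8) by (intro mult_right_mono) auto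
  then show "x * a \<le> 1" using assms(10) by simp
qed (use assms in auto)

lemma F_Suc_bounds:
  assumes "F k x \<in> {a..b}" "F k y \<in> {c..d}" "y = x\<^sup>2" "x \<in> {l..u}" "T_converges x" "u \<le> 1"
    "0 \<le> l" "0 \<le> a" "0 \<le> c" "k' = Suc k"
    "a' \<le> l / 2 * (a\<^sup>2 + c)" "u / 2 * (b\<^sup>2 + d) \<le> b'"
  shows "F k' x \<in> {a'..b'}"
proof -
  have "(F k x)\<^sup>2 \<in> {a\<^sup>2..b\<^sup>2}"
    using assms(1,8) by (auto intro!: power_mono)
  then have "l / 2 * (a\<^sup>2 + c) \<le> x / 2 * ((F k x)\<^sup>2 + F k y)"
      "x / 2 * ((F k x)\<^sup>2 + F k y) \<le> u / 2 * (b\<^sup>2 + d)"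
    using assms(2,4,7,8,9) by (auto intro!: mult_mono add_mono)
  moreover have "F k' x = x / 2 * ((F k x)\<^sup>2 + F k y)"
    using F_Suc[of x k] assms by simp
  ultimately show ?thesis using assms(11,12) by simp
qed

lemma iterated_square_bounds:
  fixes x :: real
  assumes "x \<in> {40269750367144129094 / 10 ^ 20..
      40269750367144129098 / 10 ^ 20}"
  shows "x ^ 2 \<in> {16216527946321047199 / 10 ^ 20..
      16216527946321047203 / 10 ^ 20}"
    and "x ^ 4 \<in> {2629757786338115206 / 10 ^ 20..
      2629757786338115208 / 10 ^ 20}"
    and "x ^ 8 \<in> {69156260148059439 / 10 ^ 20..
      69156260148059440 / 10 ^ 20}"
    and "x ^ 16 \<in> {47825883176660 / 10 ^ 20..
      47825883176661 / 10 ^ 20}"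
    and "x ^ 32 \<in> {22873151 / 10 ^ 20..
      22873152 / 10 ^ 20}"
proof -
  show x2: "x ^ 2 \<in> {16216527946321047199 / 10 ^ 20..
      16216527946321047203 / 10 ^ 20}"
    by (rule square_bounds[OF assms]) (simp_all add: power_divide flip: power_mult)
  show x4: "x ^ 4 \<in> {2629757786338115206 / 10 ^ 20..
      2629757786338115208 / 10 ^ 20}"
    by (rule square_bounds[OF x2]) (simp_all add: power_divide flip: power_mult)
  show x8: "x ^ 8 \<in> {69156260148059439 / 10 ^ 20..
      69156260148059440 / 10 ^ 20}"
    by (rule square_bounds[OF x4]) (simp_all add: power_divide flip: power_mult)
  show x16: "x ^ 16 \<in> {47825883176660 / 10 ^ 20..
      47825883176661 / 10 ^ 20}"
    by (rule square_bounds[OF x8]) (simp_all add: power_divide flip: power_mult)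
  show x32: "x ^ 32 \<in> {22873151 / 10 ^ 20..
      22873152 / 10 ^ 20}"
    by (rule square_bounds[OF x16]) (simp_all add: power_divide flip: power_mult)
qed

text \<open>
  The hypothesis admits every \<open>x\<close> in the interval, in particular its end points: the bounds there
  are what locates \<open>\<rho>\<close> in the interval, and only then can \<open>x\<close> be \<open>\<rho>\<close> itself. The lower bounds
  start from \<open>F 0 \<ge> 1\<close> at \<open>x ^ 64\<close>, where the excess over 1 is far below one unit of the last
  digit.
\<close>

lemma T_bounds_iterated_squares:
  fixes x :: real
  assumes "x \<in> {40269750367144129094 / 10 ^ 20..
      40269750367144129098 / 10 ^ 20}"
  shows "T_converges (x ^ 2)" "F 0 (x ^ 2) \<in> {120004105256863175779 / 10 ^ 20..
      120004105256863175787 / 10 ^ 20}"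
    and "T_converges (x ^ 4)" "F 0 (x ^ 4) \<in> {102702702739577071135 / 10 ^ 20..
      102702702739577071139 / 10 ^ 20}"
    and "T_converges (x ^ 8)" "F 0 (x ^ 8) \<in> {100069204152249134958 / 10 ^ 20..
      100069204152249134960 / 10 ^ 20}"
    and "T_converges (x ^ 16)" "F 0 (x ^ 16) \<in> {100000047825906049832 / 10 ^ 20..
      100000047825906049834 / 10 ^ 20}"
    and "T_converges (x ^ 32)" "F 0 (x ^ 32) \<in> {100000000000022873151 / 10 ^ 20..
      100000000000022873153 / 10 ^ 20}"
proof -
  note x = iterated_square_bounds[OF assms]
  have u32: "T_converges (x ^ 32) \<and> F 0 (x ^ 32) \<le> 100000000000022873153 / 10 ^ 20"
  proof (rule T_supersolution_crude)
    define b :: real where "b = 100000000000022873153 / 10 ^ 20"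
    have "1 + x ^ 32 / 2 * (b\<^sup>2 + b) \<le> 1 + 22873152 / 10 ^ 20 / 2 * (b\<^sup>2 + b)"
      using x(5) by (intro add_left_mono mult_right_mono) (auto simp: b_def)
    also have "\<dots> \<le> b" by (simp add: b_def power2_eq_square)
    finally show "1 + x ^ 32 / 2 * ((100000000000022873153 / 10 ^ 20)\<^sup>2 + 100000000000022873153 / 10 ^ 20) \<le> 100000000000022873153 / 10 ^ 20"
      by (simp only: b_def)
  qed (use x(5) in auto)
  have u16: "T_converges (x ^ 16) \<and> F 0 (x ^ 16) \<le> 100000047825906049834 / 10 ^ 20"
    by (rule T_upper_bound[OF x(4) _ u32]) (simp_all add: power_divide flip: power_mult)
  have u8: "T_converges (x ^ 8) \<and> F 0 (x ^ 8) \<le> 100069204152249134960 / 10 ^ 20"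
    by (rule T_upper_bound[OF x(3) _ u16]) (simp_all add: power_divide flip: power_mult)
  have u4: "T_converges (x ^ 4) \<and> F 0 (x ^ 4) \<le> 102702702739577071139 / 10 ^ 20"
    by (rule T_upper_bound[OF x(2) _ u8]) (simp_all add: power_divide flip: power_mult)
  have u2: "T_converges (x ^ 2) \<and> F 0 (x ^ 2) \<le> 120004105256863175787 / 10 ^ 20"
    by (rule T_upper_bound[OF x(1) _ u4]) (simp_all add: power_divide flip: power_mult)
  have sq32: "T_converges ((x ^ 32)\<^sup>2)"
    by (rule T_converges_square[OF conjunct1[OF u32]]) (use x(5) in auto)
  have l32: "100000000000022873151 / 10 ^ 20 \<le> F 0 (x ^ 32)"
    by (rule T_lower_bound[OF x(5) _ _ conjunct1[OF u32] F_0_ge_1[OF sq32]]) (simp_all add: power_divide)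
  have l16: "100000047825906049832 / 10 ^ 20 \<le> F 0 (x ^ 16)"
    by (rule T_lower_bound[OF x(4) _ _ conjunct1[OF u16] l32]) (simp_all add: power_divide flip: power_mult)
  have l8: "100069204152249134958 / 10 ^ 20 \<le> F 0 (x ^ 8)"
    by (rule T_lower_bound[OF x(3) _ _ conjunct1[OF u8] l16]) (simp_all add: power_divide flip: power_mult)
  have l4: "102702702739577071135 / 10 ^ 20 \<le> F 0 (x ^ 4)"
    by (rule T_lower_bound[OF x(2) _ _ conjunct1[OF u4] l8]) (simp_all add: power_divide flip: power_mult)
  have l2: "120004105256863175779 / 10 ^ 20 \<le> F 0 (x ^ 2)"
    by (rule T_lower_bound[OF x(1) _ _ conjunct1[OF u2] l4]) (simp_all add: power_divide flip: power_mult)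
  show "T_converges (x ^ 2)" "F 0 (x ^ 2) \<in> {120004105256863175779 / 10 ^ 20..
      120004105256863175787 / 10 ^ 20}"
    "T_converges (x ^ 4)" "F 0 (x ^ 4) \<in> {102702702739577071135 / 10 ^ 20..
      102702702739577071139 / 10 ^ 20}"
    "T_converges (x ^ 8)" "F 0 (x ^ 8) \<in> {100069204152249134958 / 10 ^ 20..
      100069204152249134960 / 10 ^ 20}"
    "T_converges (x ^ 16)" "F 0 (x ^ 16) \<in> {100000047825906049832 / 10 ^ 20..
      100000047825906049834 / 10 ^ 20}"
    "T_converges (x ^ 32)" "F 0 (x ^ 32) \<in> {100000000000022873151 / 10 ^ 20..
      100000000000022873153 / 10 ^ 20}"
    using u2 u4 u8 u16 u32 l2 l4 l8 l16 l32 by auto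
qed

text \<open>
  The discriminant is nonnegative at the lower end point, so the series converges there, and
  negative at the upper end point, where convergence would make it a square.
\<close>

lemma rho_bounds: "\<rho> \<in> {40269750367144129094 / 10 ^ 20..
      40269750367144129098 / 10 ^ 20}"
proof -
  define lo hi :: real where "lo = 40269750367144129094 / 10 ^ 20" and "hi = 40269750367144129098 / 10 ^ 20"
  have "lo \<in> {lo..hi}" "hi \<in> {lo..hi}" by (simp_all add: lo_def hi_def)
  note lo = T_bounds_iterated_squares(1,2)[OF this(1)[unfolded lo_def hi_def], folded lo_def]
    and hi = T_bounds_iterated_squares(1,2)[OF this(2)[unfolded lo_def hi_def], folded hi_def]
  have "lo\<^sup>2 * F 0 (lo\<^sup>2) \<le> lo\<^sup>2 * (120004105256863175787 / 10 ^ 20)"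
    using lo(2) by (intro mult_left_mono) auto
  also have "\<dots> \<le> 1 - 2 * lo" by (simp add: lo_def power2_eq_square)
  finally have "0 \<le> discriminant lo" by (simp add: discriminant_def)
  then have "T_converges lo"
    using T_converges_if_discriminant_nonneg[of lo] lo(1) by (simp add: lo_def)
  then have 1: "lo \<le> \<rho>" by (intro T_converges_le) (simp_all add: lo_def)
  have "1 - 2 * hi < hi\<^sup>2 * (120004105256863175779 / 10 ^ 20)" by (simp add: hi_def power2_eq_square)
  also have "\<dots> \<le> hi\<^sup>2 * F 0 (hi\<^sup>2)"
    using hi(2) by (intro mult_left_mono) auto
  finally have "discriminant hi < 0" by (simp add: discriminant_def)
  then have "\<not> T_converges hi"
    using discriminant_eq[of hi] by (auto simp: hi_def not_less[symmetric])
  moreover have "0 \<le> hi" by (simp add: hi_def)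
  ultimately have 2: "\<rho> \<le> hi" using T_converges_less[of hi] by (meson not_less)
  from 1 2 show ?thesis by (simp add: lo_def hi_def)
qed

lemma F_rho_bounds:
  shows "F 1 \<rho> \<in> {148325353617263685849 / 10 ^ 20..
      148325353617263685875 / 10 ^ 20}"
    and "F 2 \<rho> \<in> {48325353617263685847 / 10 ^ 20..
      48325353617263685870 / 10 ^ 20}"
    and "F 3 \<rho> \<in> {4811631930728862152 / 10 ^ 20..
      4811631930728862159 / 10 ^ 20}"
    and "F 4 \<rho> \<in> {46694644473216834 / 10 ^ 20..
      46694644473216836 / 10 ^ 20}"
    and "F 5 \<rho> \<in> {4390227300464 / 10 ^ 20..
      4390227300465 / 10 ^ 20}"
proof -
  note x = rho_bounds iterated_square_bounds[OF rho_bounds]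
  note T = T_bounds_iterated_squares[OF rho_bounds]
  have "1 / \<rho> \<in> {248325353617263685849 / 10 ^ 20..
      248325353617263685875 / 10 ^ 20}"
    using rho_bounds by (auto simp: le_divide_eq divide_le_eq)
  then have T0: "F 0 \<rho> \<in> {248325353617263685849 / 10 ^ 20..
      248325353617263685875 / 10 ^ 20}"
    by (simp only: T_rho)
  have F1_0: "F 1 \<rho> \<in> {148325353617263685849 / 10 ^ 20..
      148325353617263685875 / 10 ^ 20}"
    using T0 F_1[OF T_converges_rho] by simp
  have F1_1: "F 1 (\<rho> ^ 2) \<in> {20004105256863175779 / 10 ^ 20..
      20004105256863175787 / 10 ^ 20}"
    using T(2) F_1[OF T(1)] by simp
  have F1_2: "F 1 (\<rho> ^ 4) \<in> {2702702739577071135 / 10 ^ 20..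
      2702702739577071139 / 10 ^ 20}"
    using T(4) F_1[OF T(3)] by simp
  have F1_3: "F 1 (\<rho> ^ 8) \<in> {69204152249134958 / 10 ^ 20..
      69204152249134960 / 10 ^ 20}"
    using T(6) F_1[OF T(5)] by simp
  have F1_4: "F 1 (\<rho> ^ 16) \<in> {47825906049832 / 10 ^ 20..
      47825906049834 / 10 ^ 20}"
    using T(8) F_1[OF T(7)] by simp
  have F2_0: "F 2 \<rho> \<in> {48325353617263685847 / 10 ^ 20..
      48325353617263685870 / 10 ^ 20}"
    by (rule F_Suc_bounds[OF F1_0 F1_1 _ x(1) T_converges_rho])
      (simp_all add: power_divide flip: power_mult)
  have F2_1: "F 2 (\<rho> ^ 2) \<in> {543605991151433977 / 10 ^ 20..
      543605991151433979 / 10 ^ 20}"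
    by (rule F_Suc_bounds[OF F1_1 F1_2 _ x(2) T(1)])
      (simp_all add: power_divide flip: power_mult)
  have F2_2: "F 2 (\<rho> ^ 4) \<in> {1870417503354349 / 10 ^ 20..
      1870417503354350 / 10 ^ 20}"
    by (rule F_Suc_bounds[OF F1_2 F1_3 _ x(3) T(3)])
      (simp_all add: power_divide flip: power_mult)
  have F2_3: "F 2 (\<rho> ^ 8) \<in> {33097512848 / 10 ^ 20..
      33097512849 / 10 ^ 20}"
    by (rule F_Suc_bounds[OF F1_3 F1_4 _ x(4) T(5)])
      (simp_all add: power_divide flip: power_mult)
  have F3_0: "F 3 \<rho> \<in> {4811631930728862152 / 10 ^ 20..
      4811631930728862159 / 10 ^ 20}"
    by (rule F_Suc_bounds[OF F2_0 F2_1 _ x(1) T_converges_rho])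
      (simp_all add: power_divide flip: power_mult)
  have F3_1: "F 3 (\<rho> ^ 2) \<in> {391263648783982 / 10 ^ 20..
      391263648783983 / 10 ^ 20}"
    by (rule F_Suc_bounds[OF F2_1 F2_2 _ x(2) T(1)])
      (simp_all add: power_divide flip: power_mult)
  have F3_2: "F 3 (\<rho> ^ 4) \<in> {895197547 / 10 ^ 20..
      895197548 / 10 ^ 20}"
    by (rule F_Suc_bounds[OF F2_2 F2_3 _ x(3) T(3)])
      (simp_all add: power_divide flip: power_mult)
  have F4_0: "F 4 \<rho> \<in> {46694644473216834 / 10 ^ 20..
      46694644473216836 / 10 ^ 20}"
    by (rule F_Suc_bounds[OF F3_0 F3_1 _ x(1) T_converges_rho])
      (simp_all add: power_divide flip: power_mult)
  have F4_1: "F 4 (\<rho> ^ 2) \<in> {196712157 / 10 ^ 20..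
      196712158 / 10 ^ 20}"
    by (rule F_Suc_bounds[OF F3_1 F3_2 _ x(2) T(1)])
      (simp_all add: power_divide flip: power_mult)
  have F5_0: "F 5 \<rho> \<in> {4390227300464 / 10 ^ 20..
      4390227300465 / 10 ^ 20}"
    by (rule F_Suc_bounds[OF F4_0 F4_1 _ x(1) T_converges_rho])
      (simp_all add: power_divide flip: power_mult)
  show "F 1 \<rho> \<in> {148325353617263685849 / 10 ^ 20..
      148325353617263685875 / 10 ^ 20}"
    "F 2 \<rho> \<in> {48325353617263685847 / 10 ^ 20..
      48325353617263685870 / 10 ^ 20}"
    "F 3 \<rho> \<in> {4811631930728862152 / 10 ^ 20..
      4811631930728862159 / 10 ^ 20}"
    "F 4 \<rho> \<in> {46694644473216834 / 10 ^ 20..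
      46694644473216836 / 10 ^ 20}"
    "F 5 \<rho> \<in> {4390227300464 / 10 ^ 20..
      4390227300465 / 10 ^ 20}"
    by (fact F1_0 F2_0 F3_0 F4_0 F5_0)+
qed

lemma limit_tail_Suc_bounds:
  assumes "limit_tail k \<in> {a..b}" "F k \<rho> \<in> {c..d}" "0 \<le> a" "0 \<le> c" "k' = Suc k"
    "a' \<le> a * ((40269750367144129094 / 10 ^ 20) * c)" "b * ((40269750367144129098 / 10 ^ 20) * d) \<le> b'"
  shows "limit_tail k' \<in> {a'..b'}"
proof -
  have "a * ((40269750367144129094 / 10 ^ 20) * c) \<le> limit_tail k * (\<rho> * F k \<rho>)"
    using assms(1-4) rho_bounds by (intro mult_mono) auto
  moreover have "limit_tail k * (\<rho> * F k \<rho>) \<le> b * ((40269750367144129098 / 10 ^ 20) * d)"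
    using assms(1-4) rho_bounds by (intro mult_mono) auto
  ultimately show ?thesis using assms(5-7) by (simp add: limit_tail_def)
qed

lemma limit_tail_bounds:
  shows "limit_tail 1 = 1"
    and "limit_tail 2 \<in> {59730249632855870895 / 10 ^ 20..
      59730249632855870913 / 10 ^ 20}"
    and "limit_tail 3 \<in> {11623804791209707108 / 10 ^ 20..
      11623804791209707119 / 10 ^ 20}"
    and "limit_tail 4 \<in> {225226580674263944 / 10 ^ 20..
      225226580674263946 / 10 ^ 20}"
    and "limit_tail 5 \<in> {42351193534238 / 10 ^ 20..
      42351193534239 / 10 ^ 20}"
    and "limit_tail 6 \<in> {748740 / 10 ^ 20..
      748741 / 10 ^ 20}"
proof -
  show p1: "limit_tail 1 = 1" by (simp add: limit_tail_def T_rho less_imp_neq[OF rho_pos, symmetric])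
  then have p1': "limit_tail 1 \<in> {1..1}" by simp
  show p2: "limit_tail 2 \<in> {59730249632855870895 / 10 ^ 20..
      59730249632855870913 / 10 ^ 20}"
    by (rule limit_tail_Suc_bounds[OF p1' F_rho_bounds(1)]) simp_all
  show p3: "limit_tail 3 \<in> {11623804791209707108 / 10 ^ 20..
      11623804791209707119 / 10 ^ 20}"
    by (rule limit_tail_Suc_bounds[OF p2 F_rho_bounds(2)]) simp_all
  show p4: "limit_tail 4 \<in> {225226580674263944 / 10 ^ 20..
      225226580674263946 / 10 ^ 20}"
    by (rule limit_tail_Suc_bounds[OF p3 F_rho_bounds(3)]) simp_all
  show p5: "limit_tail 5 \<in> {42351193534238 / 10 ^ 20..
      42351193534239 / 10 ^ 20}"
    by (rule limit_tail_Suc_bounds[OF p4 F_rho_bounds(4)]) simp_all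
  show p6: "limit_tail 6 \<in> {748740 / 10 ^ 20..
      748741 / 10 ^ 20}"
    by (rule limit_tail_Suc_bounds[OF p5 F_rho_bounds(5)]) simp_all
qed

text \<open>
  Six terms suffice: \<open>limit_tail 6\<close> is less than \<open>1 / 10 ^ 14\<close>, and as \<open>F k \<rho>\<close> decreases with \<open>k\<close>,
  each further factor is at most \<open>\<rho> * F 5 \<rho>\<close>, which is less than \<open>1 / 10 ^ 7\<close>. The bound on the
  weights covers the first two moments.
\<close>

lemma limit_series_bounds:
  fixes c :: "nat \<Rightarrow> real"
  assumes c: "\<And>k. 0 \<le> c k" "\<And>k. c k \<le> 2 * real k + 1"
  defines "p \<equiv> c 0 * limit_tail 1 + c 1 * limit_tail 2 + c 2 * limit_tail 3 +
    c 3 * limit_tail 4 + c 4 * limit_tail 5 + c 5 * limit_tail 6"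
  shows "(\<Sum>k. c k * limit_tail (Suc k)) \<in> {p..p + 1 / 10 ^ 18}"
proof -
  define r :: real where "r = 1 / 10 ^ 7"
  have p: "(\<Sum>k<6. c k * limit_tail (Suc k)) = p"
    unfolding p_def by (simp add: eval_nat_numeral)
  have pos: "0 \<le> limit_tail k" for k
    unfolding limit_tail_def by (intro prod_nonneg ballI mult_nonneg_nonneg F_nonneg T_converges_rho) auto
  have step: "\<rho> * F (6 + j) \<rho> \<le> r" for j
  proof -
    have "F (6 + j) \<rho> \<le> F 5 \<rho>" by (intro F_antimono T_converges_rho) auto
    then have "\<rho> * F (6 + j) \<rho> \<le> \<rho> * F 5 \<rho>" by (intro mult_left_mono) auto
    also have "\<dots> \<le> 1 * F 5 \<rho>"
      using rho_le_half by (intro mult_right_mono F_nonneg T_converges_rho) auto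
    also have "\<dots> \<le> r" using F_rho_bounds(5) by (simp add: r_def)
    finally show ?thesis .
  qed
  have geo: "limit_tail (7 + j) \<le> 1 / 10 ^ 14 * r ^ Suc j" for j
  proof -
    have "limit_tail (6 + j) \<le> 1 / 10 ^ 14 * r ^ j" for j
    proof (induction j)
      case 0
      show ?case using limit_tail_bounds(6) by simp
    next
      case (Suc j)
      have "limit_tail (6 + Suc j) = limit_tail (6 + j) * (\<rho> * F (6 + j) \<rho>)"
        by (simp only: limit_tail_def add_Suc_right prod.lessThan_Suc)
      also have "\<dots> \<le> (1 / 10 ^ 14 * r ^ j) * r"
        by (intro mult_mono Suc.IH step mult_nonneg_nonneg F_nonneg T_converges_rho) (auto simp: r_def)
      finally show ?case by (simp add: mult_ac)
    qed
    from this[of "Suc j"] show ?thesis by (simp add: eval_nat_numeral)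
  qed
  \<comment> \<open>the ratio \<open>2 * r\<close> that this bound leads to is still tiny\<close>
  have weight: "c (6 + j) \<le> 13 * 2 ^ j" for j
  proof -
    have "2 * real (6 + j) + 1 \<le> 13 * 2 ^ j" for j
      by (induction j) auto
    then show ?thesis using c(2)[of "6 + j"] by (rule order_trans[rotated])
  qed
  define d where "d j = c (6 + j) * limit_tail (Suc (6 + j))" for j
  have d: "0 \<le> d j" for j using c(1) pos by (simp add: d_def)
  have d_le: "d j \<le> 13 / 10 ^ 21 * (2 * r) ^ j" for j
  proof -
    have "d j \<le> (13 * 2 ^ j) * (1 / 10 ^ 14 * r ^ Suc j)"
      unfolding d_def using geo[of j] by (intro mult_mono weight pos) (auto simp: eval_nat_numeral)
    also have "\<dots> = 13 * (1 / 10 ^ 14 * r) * (2 * r) ^ j"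
      by (simp add: power_mult_distrib)
    also have "13 * (1 / 10 ^ 14 * r) = 13 / 10 ^ 21"
      by (simp add: r_def)
    finally show ?thesis .
  qed
  have g: "(\<lambda>j. 13 / 10 ^ 21 * (2 * r) ^ j) sums (13 / 10 ^ 21 * (1 / (1 - 2 * r)))"
    by (intro sums_mult geometric_sums) (simp add: r_def)
  have sd: "summable d"
    by (rule summable_comparison_test[OF _ sums_summable[OF g]]) (use d d_le in auto)
  then have "summable (\<lambda>k. c k * limit_tail (Suc k))"
    unfolding d_def using summable_iff_shift[of "\<lambda>k. c k * limit_tail (Suc k)" 6] by (simp add: add.commute)
  then have "(\<Sum>k. c k * limit_tail (Suc k)) = (\<Sum>j. d j) + p"
    unfolding p[symmetric] d_def using suminf_split_initial_segment[of "\<lambda>k. c k * limit_tail (Suc k)" 6]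
    by (simp add: add.commute)
  moreover have "0 \<le> (\<Sum>j. d j)" using sd d by (rule suminf_nonneg)
  moreover have "(\<Sum>j. d j) \<le> 13 / 10 ^ 21 * (1 / (1 - 2 * r))"
    using suminf_le[OF d_le sd sums_summable[OF g]] g by (simp only: sums_unique[symmetric])
  moreover have "13 / 10 ^ 21 * (1 / (1 - 2 * r)) \<le> 1 / 10 ^ 18" by (simp add: r_def)
  ultimately show ?thesis by simp
qed

lemma mean_bounds:
  "(\<Sum>k. limit_tail (Suc k)) \<in> {171579323355934124925 / 10 ^ 20..
      171579323355934125058 / 10 ^ 20}"
  using limit_series_bounds[of "\<lambda>_. 1"] limit_tail_bounds
  by simp

lemma second_moment_bounds:
  "(\<Sum>k. (2 * real k + 1) * limit_tail (Suc k)) \<in> {338886740080086040115 / 10 ^ 20..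
      338886740080086040358 / 10 ^ 20}"
  using limit_series_bounds[of "\<lambda>k. 2 * real k + 1"] limit_tail_bounds
  by simp

section \<open>Mean and variance\<close>

lemma prod_eq_limit_tail: "(\<Prod>i=1..k-1. \<rho> * F i \<rho>) = limit_tail k" if "1 \<le> k"
proof -
  have "{..<k} = insert 0 {1..k-1}" using that by auto
  then show ?thesis
    by (simp add: limit_tail_def T_rho less_imp_neq[OF rho_pos, symmetric])
qed

theorem theorem5:
  shows "\<exists>\<mu> v :: real.
    (\<lambda>n. measure_pmf.expectation (random_binary_tree n) (\<lambda>t. real (protection_number t)))
      \<longlonglongrightarrow> \<mu> \<and>
    ((\<lambda>k. \<Prod>i=1..k-1. \<rho> * eval_fps (T_prot i) \<rho>) has_sum \<mu>) {k::nat. k \<ge> 1} \<and>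
    \<bar>\<mu> - 1.715793233559341\<bar> \<le> 5 / 10 ^ 16 \<and>
    (\<lambda>n. measure_pmf.variance (random_binary_tree n) (\<lambda>t. real (protection_number t)))
      \<longlonglongrightarrow> v \<and>
    \<bar>v - 0.444920980472840\<bar> \<le> 5 / 10 ^ 16"
proof -
  define \<mu> where "\<mu> = (\<Sum>k. limit_tail (Suc k))"
  define m2 where "m2 = (\<Sum>k. (2 * real k + 1) * limit_tail (Suc k))"
  have mean_lim: "(\<lambda>n. measure_pmf.expectation (random_binary_tree n) (\<lambda>t. real (protection_number t)))
      \<longlonglongrightarrow> \<mu>"
    using expectation_tendsto(2)[of real] by (simp add: \<mu>_def)
  have square_diff: "(real (Suc k))\<^sup>2 - (real k)\<^sup>2 = 2 * real k + 1" for k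
    by (simp add: power2_eq_square algebra_simps)
  have moment_lim: "(\<lambda>n. measure_pmf.expectation (random_binary_tree n)
      (\<lambda>t. (real (protection_number t))\<^sup>2)) \<longlonglongrightarrow> m2"
    using expectation_tendsto(2)[of "\<lambda>k. (real k)\<^sup>2"] by (simp only: square_diff m2_def) simp
  have "measure_pmf.variance (random_binary_tree n) (\<lambda>t. real (protection_number t)) =
      measure_pmf.expectation (random_binary_tree n) (\<lambda>t. (real (protection_number t))\<^sup>2) -
      (measure_pmf.expectation (random_binary_tree n) (\<lambda>t. real (protection_number t)))\<^sup>2" for n
  proof (rule measure_pmf.variance_eq)
    have "finite (set_pmf (random_binary_tree n))"
      using finite_binary_trees binary_trees_nonempty by (simp add: random_binary_tree_def)
    then show "integrable (random_binary_tree n) (\<lambda>t. real (protection_number t))"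
      "integrable (random_binary_tree n) (\<lambda>t. (real (protection_number t))\<^sup>2)"
      by (auto intro: integrable_measure_pmf_finite)
  qed
  then have variance_lim: "(\<lambda>n. measure_pmf.variance (random_binary_tree n)
      (\<lambda>t. real (protection_number t))) \<longlonglongrightarrow> m2 - \<mu>\<^sup>2"
    by (simp only:) (intro tendsto_intros mean_lim moment_lim)
  have "((\<lambda>k. limit_tail (Suc k)) has_sum \<mu>) UNIV"
  proof (rule norm_summable_imp_has_sum)
    have sm: "summable (\<lambda>k. limit_tail (Suc k))"
      using expectation_tendsto(1)[of real] by simp
    then show "(\<lambda>k. limit_tail (Suc k)) sums \<mu>" by (simp add: \<mu>_def summable_sums)
    have "0 \<le> limit_tail k" for k
      unfolding limit_tail_def by (intro prod_nonneg ballI mult_nonneg_nonneg F_nonneg T_converges_rho) auto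
    then show "summable (\<lambda>k. norm (limit_tail (Suc k)))" using sm by simp
  qed
  then have "(limit_tail has_sum \<mu>) (range Suc)"
    by (subst has_sum_reindex) (auto simp: o_def)
  also have "range Suc = {k. k \<ge> 1}"
    by (auto simp: image_iff Suc_le_eq gr0_conv_Suc)
  also have "(limit_tail has_sum \<mu>) {k. k \<ge> 1} \<longleftrightarrow>
      ((\<lambda>k. \<Prod>i=1..k-1. \<rho> * F i \<rho>) has_sum \<mu>) {k. k \<ge> 1}"
    by (rule has_sum_cong) (use prod_eq_limit_tail in auto)
  finally have sum: "((\<lambda>k. \<Prod>i=1..k-1. \<rho> * F i \<rho>) has_sum \<mu>) {k. k \<ge> 1}" .
  have \<mu>: "\<mu> \<in> {171579323355934124925 / 10 ^ 20..171579323355934125058 / 10 ^ 20}"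
    using mean_bounds by (simp add: \<mu>_def)
  have sq: "\<mu>\<^sup>2 \<in> {(171579323355934124925 / 10 ^ 20)\<^sup>2..(171579323355934125058 / 10 ^ 20)\<^sup>2}"
    by (rule square_bounds[OF \<mu>]) simp_all
  have "\<bar>\<mu> - 1.715793233559341\<bar> \<le> 5 / 10 ^ 16"
    using \<mu> by (simp add: abs_le_iff)
  moreover have "\<bar>(m2 - \<mu>\<^sup>2) - 0.444920980472840\<bar> \<le> 5 / 10 ^ 16"
    using sq second_moment_bounds by (simp add: m2_def[symmetric] abs_le_iff power_divide)
  ultimately show ?thesis
    using mean_lim variance_lim sum by blast
qed

end
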